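(* For each $i\in\{1,2,3\}$ and all smooth functions $f,h:\mathbb{S}^2\to\mathbb{R}$, $$2\int_{\mathbb{S}^2}\phi_i\,\langle J\nabla f,\nabla h\rangle\,dM\;\le\;\sqrt{\int_{\mathbb{S}^2}\|\nabla f\|^2dM}\;\sqrt{\int_{\mathbb{S}^2}\|\nabla h\|^2dM}.$$ Furthermore, equality holds if and only if either $f$ or $h$ is constant, or $$f=c_j\phi_j+c_k\phi_k+c,\qquad h=-c_k\phi_j+c_j\phi_k+c',$$ where $c_j,c_k,c,c'$ are constants and $(i,j,k)$ is a positive (even) permutation of $(1,2,3)$.
   Context: $\mathbb{S}^2\subset\mathbb{R}^3$ is the unit sphere with its induced metric $\langle\cdot,\cdot\rangle$, area element $dM$ and gradient $\nabla$. $\phi=(\phi_1,\phi_2,\phi_3):\mathbb{S}^2\to\mathbb{R}^3$ is the inclusion map, so the $\phi_i$ are the coordinate functions. $J$ is the complex structure of $\mathbb{S}^2$ (rotation by $+90^\circ$ in tangent planes) for the orientation given by the outward normal, i.e. $J_xv=x\times v$ for $v\in T_x\mathbb{S}^2$; with this convention $\langle J\nabla\phi_1,\nabla\phi_2\rangle=\phi_3$.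
   Formalization: The printed "only if" in the equality case fails (i=3, f=φ_1, h=2φ_2 gives equality); the formal version allows an extra constant a>0: h = a(-c_k φ_j + c_j φ_k) + c', with f as printed. *)

theory Defs
  imports "HOL-Analysis.Analysis" "HOL-Combinatorics.Permutations"
begin

abbreviation S2 :: "(real^3) set" where
  "S2 \<equiv> sphere 0 1"

(* Functions on the sphere are total functions on real^3 of which only the values on S2 are
   used; the inclusion map has the components \<lambda>x. x $ i. *)

primrec Ck_on :: "nat \<Rightarrow> (real^3) set \<Rightarrow> (real^3 \<Rightarrow> real) \<Rightarrow> bool" where
  "Ck_on 0 U F \<longleftrightarrow> continuous_on U F"
| "Ck_on (Suc k) U F \<longleftrightarrow> (\<forall>x\<in>U. F differentiable at x) \<and>
     (\<forall>v. Ck_on k U (\<lambda>x. frechet_derivative F (at x) v))"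

(* Smoothness on the embedded submanifold S2: local extendability to C-infinity functions on
   open subsets of the ambient space. *)
definition smooth_on_S2 :: "(real^3 \<Rightarrow> real) \<Rightarrow> bool" where
  "smooth_on_S2 f \<longleftrightarrow> (\<forall>x\<in>S2. \<exists>U F. open U \<and> x \<in> U \<and> (\<forall>k. Ck_on k U F) \<and>
     (\<forall>y\<in>U \<inter> S2. F y = f y))"

definition tangent_S2 :: "real^3 \<Rightarrow> (real^3) set" where
  "tangent_S2 x = {v. x \<bullet> v = 0}"

(* The derivative D within S2 is determined only on tangent vectors, where it is the intrinsic
   differential of f; see grad_S2_eqI for well-definedness of the gradient. *)
definition grad_S2 :: "(real^3 \<Rightarrow> real) \<Rightarrow> real^3 \<Rightarrow> real^3" where
  "grad_S2 f x = (THE v. v \<in> tangent_S2 x \<and>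
     (\<exists>D. (f has_derivative D) (at x within S2) \<and> (\<forall>w\<in>tangent_S2 x. v \<bullet> w = D w)))"

definition J_S2 :: "real^3 \<Rightarrow> real^3 \<Rightarrow> real^3" where
  "J_S2 x v = cross3 x v"

definition spherical :: "real \<Rightarrow> real \<Rightarrow> real^3" where
  "spherical \<theta> \<psi> = vector [sin \<theta> * cos \<psi>, sin \<theta> * sin \<psi>, cos \<theta>]"

(* The Riemannian area density sqrt (det g) of the induced metric in the coordinates
   (\<theta>, \<psi>); see area_density_eq. *)
definition area_density :: "real \<Rightarrow> real \<Rightarrow> real" where
  "area_density \<theta> \<psi> =
     (let X\<^sub>\<theta> = vector_derivative (\<lambda>s. spherical s \<psi>) (at \<theta>);
          X\<^sub>\<psi> = vector_derivative (\<lambda>t. spherical \<theta> t) (at \<psi>)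
      in sqrt ((X\<^sub>\<theta> \<bullet> X\<^sub>\<theta>) * (X\<^sub>\<psi> \<bullet> X\<^sub>\<psi>) - (X\<^sub>\<theta> \<bullet> X\<^sub>\<psi>)\<^sup>2))"

(* The chart spherical on (0,pi) x (0,2pi) covers S2 up to half a great circle, a null set.
   The target restrict_space borel S2 has S2 as its space, so that values of integrands off
   the sphere play no role, not even for measurability. *)
definition area_S2 :: "(real^3) measure" where
  "area_S2 = distr
     (density (restrict_space lborel ({0<..<pi} \<times> {0<..<2 * pi}))
        (\<lambda>(\<theta>, \<psi>). ennreal (area_density \<theta> \<psi>)))
     (restrict_space borel S2) (\<lambda>(\<theta>, \<psi>). spherical \<theta> \<psi>)"

definition even_triple :: "3 \<Rightarrow> 3 \<Rightarrow> 3 \<Rightarrow> bool" where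
  "even_triple i j k \<longleftrightarrow>
     (\<exists>p. p permutes (UNIV :: 3 set) \<and> evenperm p \<and> p 1 = i \<and> p 2 = j \<and> p 3 = k)"

lemma tangent_derivative_unique:
  assumes x: "x \<in> S2" and w: "w \<in> tangent_S2 x"
    and D: "(f has_derivative D) (at x within S2)" and D': "(f has_derivative D') (at x within S2)"
  shows "D w = (D' w :: real)"
proof -
  have lin: "linear D" "linear D'"
    using D D' has_derivative_linear by blast+
  have unit: "D u = D' u" if u: "u \<in> tangent_S2 x" "norm u = 1" for u
  proof -
    define c where "c t = cos t *\<^sub>R x + sin t *\<^sub>R u" for t
    have xx: "x \<bullet> x = 1" "u \<bullet> u = 1" "x \<bullet> u = 0" "u \<bullet> x = 0"
      using x u by (auto simp: tangent_S2_def norm_eq_1 inner_commute)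
    have "c t \<bullet> c t = 1" for t
      unfolding c_def by (simp add: inner_add_left inner_add_right xx power2_eq_square[symmetric])
    hence S: "range c \<subseteq> S2"
      by (auto simp: norm_eq_1)
    have c0: "c 0 = x" by (simp add: c_def)
    have dc: "(c has_derivative (\<lambda>h. h *\<^sub>R u)) (at 0)"
      unfolding c_def by (auto intro!: derivative_eq_intros)
    have *: "((\<lambda>t. f (c t)) has_derivative (\<lambda>h. E (h *\<^sub>R u))) (at 0)"
      if "(f has_derivative E) (at x within S2)" for E
      by (rule has_derivative_in_compose[OF dc, of f E, unfolded c0])
         (rule has_derivative_subset[OF that S])
    from has_derivative_unique[OF *[OF D] *[OF D']]
    show ?thesis by (metis scaleR_one)
  qed
  show ?thesis
  proof (cases "w = 0")
    case True
    then show ?thesis using lin by (simp add: linear_0)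
  next
    case False
    have "D (w /\<^sub>R norm w) = D' (w /\<^sub>R norm w)"
      by (rule unit) (use w False in \<open>auto simp: tangent_S2_def\<close>)
    then show ?thesis using False lin by (simp add: linear_cmul)
  qed
qed

lemma grad_S2_eqI:
  assumes x: "x \<in> S2" and v: "v \<in> tangent_S2 x"
    and D: "(f has_derivative D) (at x within S2)" and vD: "\<And>w. w \<in> tangent_S2 x \<Longrightarrow> v \<bullet> w = D w"
  shows "grad_S2 f x = v"
  unfolding grad_S2_def
proof (rule the_equality)
  fix u
  assume u: "u \<in> tangent_S2 x \<and>
    (\<exists>D. (f has_derivative D) (at x within S2) \<and> (\<forall>w\<in>tangent_S2 x. u \<bullet> w = D w))"
  have "(u - v) \<bullet> w = 0" if "w \<in> tangent_S2 x" for w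
    using u vD[OF that] tangent_derivative_unique[OF x that _ D] that
    by (auto simp: inner_diff_left)
  moreover have "u - v \<in> tangent_S2 x"
    using u v by (auto simp: tangent_S2_def inner_diff_right)
  ultimately show "u = v"
    by (metis eq_iff_diff_eq_0 inner_eq_zero_iff)
qed (use assms in blast)

lemma area_density_eq:
  assumes "\<theta> \<in> {0..pi}"
  shows "area_density \<theta> \<psi> = sin \<theta>"
proof -
  let ?e = "\<lambda>k. axis k 1 :: real^3"
  have sph: "spherical a b = (sin a * cos b) *\<^sub>R ?e 1 + (sin a * sin b) *\<^sub>R ?e 2 + cos a *\<^sub>R ?e 3"
    for a b
    by (simp add: vec_eq_iff forall_3 spherical_def axis_def)
  have e: "?e k \<bullet> ?e l = (if k = l then 1 else 0)" for k l
    by (simp add: inner_axis_axis)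
  have "((\<lambda>s. spherical s \<psi>) has_vector_derivative
      (cos \<theta> * cos \<psi>) *\<^sub>R ?e 1 + (cos \<theta> * sin \<psi>) *\<^sub>R ?e 2 + (- sin \<theta>) *\<^sub>R ?e 3) (at \<theta>)"
    unfolding sph by (auto intro!: derivative_eq_intros)
  note 1 = vector_derivative_at[OF this]
  have "((\<lambda>t. spherical \<theta> t) has_vector_derivative
      (- sin \<theta> * sin \<psi>) *\<^sub>R ?e 1 + (sin \<theta> * cos \<psi>) *\<^sub>R ?e 2) (at \<psi>)"
    unfolding sph by (auto intro!: derivative_eq_intros simp: mult.commute)
  note 2 = vector_derivative_at[OF this]
  have E: "(cos \<theta> * cos \<psi>)\<^sup>2 + (cos \<theta> * sin \<psi>)\<^sup>2 + (sin \<theta>)\<^sup>2 = 1"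
    by (simp add: power_mult_distrib flip: distrib_left)
  have G: "(sin \<theta> * sin \<psi>)\<^sup>2 + (sin \<theta> * cos \<psi>)\<^sup>2 = (sin \<theta>)\<^sup>2"
    by (simp add: power_mult_distrib flip: distrib_left)
  let ?A = "(cos \<theta> * cos \<psi>) *\<^sub>R ?e 1 + (cos \<theta> * sin \<psi>) *\<^sub>R ?e 2 + (- sin \<theta>) *\<^sub>R ?e 3"
  let ?B = "(- sin \<theta> * sin \<psi>) *\<^sub>R ?e 1 + (sin \<theta> * cos \<psi>) *\<^sub>R ?e 2"
  have "?A \<bullet> ?A = 1"
    using E by (simp add: inner_add_left inner_add_right inner_diff_left inner_diff_right e
        power2_eq_square)
  moreover have "?B \<bullet> ?B = (sin \<theta>)\<^sup>2"
    using G by (simp add: inner_add_left inner_add_right inner_diff_left inner_diff_right e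
        power2_eq_square)
  moreover have "?A \<bullet> ?B = 0"
    by (simp add: inner_add_left inner_add_right inner_diff_left inner_diff_right e)
  ultimately have "area_density \<theta> \<psi> = sqrt ((sin \<theta>)\<^sup>2)"
    unfolding area_density_def Let_def 1 2 by simp
  then show ?thesis
    using assms sin_ge_zero by simp
qed

end

theory Submission
  imports Defs
begin

text \<open>
  Let \<open>i = 3\<close>. In spherical coordinates, an integration by parts gives
  \<open>\<integral> \<phi>\<^sub>3 \<langle>J\<nabla>f, \<nabla>h\<rangle> = \<integral> f \<partial>\<^sub>\<psi>h\<close>, and pointwise
  \<open>\<bar>\<nabla>f\<bar>\<^sup>2 + \<bar>\<nabla>h\<bar>\<^sup>2 - 2 \<phi>\<^sub>3 \<langle>J\<nabla>f, \<nabla>h\<rangle>\<close> is the sum of \<open>(\<partial>\<^sub>\<psi>f)\<^sup>2 + (\<partial>\<^sub>\<psi>h)\<^sup>2\<close> and of two squares. Hence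
  \<open>\<integral> \<bar>\<nabla>f\<bar>\<^sup>2 + \<integral> \<bar>\<nabla>h\<bar>\<^sup>2 - 4 \<integral> \<phi>\<^sub>3 \<langle>J\<nabla>f, \<nabla>h\<rangle>\<close> is the integral of these squares plus the integral of
  \<open>(\<partial>\<^sub>\<psi>f)\<^sup>2 + (\<partial>\<^sub>\<psi>h)\<^sup>2 - 2 f \<partial>\<^sub>\<psi>h\<close>, which is nonnegative on every circle of latitude by Wirtinger's
  inequality. Replacing \<open>f\<close>, \<open>h\<close> by \<open>s f\<close>, \<open>h / s\<close> with the optimal \<open>s\<close> turns the sum of the Dirichlet
  integrals into the product of their square roots. In the case of equality, \<open>f\<close> and \<open>h\<close> satisfy
  linear first order equations both along the circles of latitude and along the meridians, whose
  solutions are the linear functions of the statement. The other values of \<open>i\<close> follow by a cyclic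
  permutation of the coordinates.
\<close>


section \<open>Wirtinger's inequality on the circle\<close>

text \<open>The defect \<open>v'\<^sup>2 - v\<^sup>2\<close> is the square of \<open>v' - v cot\<close> up to the derivative of \<open>v\<^sup>2 cot\<close>, which is
  continuous up to the end points since \<open>v\<close> vanishes there.\<close>
lemma wirtinger_interval:
  fixes v v' :: "real \<Rightarrow> real"
  assumes dv: "\<And>t. (v has_real_derivative v' t) (at t)" and cv': "continuous_on UNIV v'"
    and va: "v a = 0" and vb: "v (a + pi) = 0"
  shows "integral {a..a + pi} (\<lambda>t. (v t)\<^sup>2) \<le> integral {a..a + pi} (\<lambda>t. (v' t)\<^sup>2)"
proof -
  define G where "G t = (v t)\<^sup>2 * cot (t - a)" for t
  define g where "g t = 2 * v t * v' t * cot (t - a) - (v t)\<^sup>2 / (sin (t - a))\<^sup>2" for t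
  have cv: "continuous_on S v" for S
    using dv by (meson DERIV_continuous_on DERIV_subset subset_UNIV)
  have sin0: "sin (t - a) > 0" if "t \<in> {a<..<a + pi}" for t
    using that by (intro sin_gt_zero) auto
  have dG: "(G has_vector_derivative g t) (at t)" if t: "t \<in> {a<..<a + pi}" for t
  proof -
    have "((\<lambda>t. cot (t - a)) has_real_derivative - inverse ((sin (t - a))\<^sup>2) * 1) (at t)"
      using sin0[OF t] by (intro DERIV_chain2[OF DERIV_cot]) (auto intro!: derivative_eq_intros)
    then show ?thesis
      unfolding has_real_derivative_iff_has_vector_derivative[symmetric] G_def g_def
      by (auto intro!: derivative_eq_intros dv simp: divide_inverse)
  qed
  have lim: "isCont G p" if p: "v p = 0" "sin (p - a) = 0" for p
  proof -
    have "((\<lambda>t. (v t - v p) / (t - p)) \<longlongrightarrow> v' p) (at p)"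
      using dv[of p] by (simp add: has_field_derivative_iff)
    then have 1: "((\<lambda>t. v t / (t - p)) \<longlongrightarrow> v' p) (at p)" using p by simp
    have "((\<lambda>t. sin (t - a)) has_real_derivative cos (p - a)) (at p)"
      by (auto intro!: derivative_eq_intros)
    then have 2: "((\<lambda>t. sin (t - a) / (t - p)) \<longlongrightarrow> cos (p - a)) (at p)"
      using p by (simp add: has_field_derivative_iff)
    have c: "cos (p - a) \<noteq> 0" using p(2) sin_zero_abs_cos_one by force
    have v0: "(v \<longlongrightarrow> v p) (at p)"
      using dv[of p] DERIV_isCont isCont_def by blast
    \<comment> \<open>Regrouping into difference quotients of \<open>v\<close> and of the sine at
      \<open>p\<close>: the latter has the nonzero limit \<open>cos (p - a)\<close>, and the spare
      factor \<open>v t\<close> tends to zero.\<close>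
    have "((\<lambda>t. v t * ((v t / (t - p)) / (sin (t - a) / (t - p))) * cos (t - a))
             \<longlongrightarrow> v p * (v' p / cos (p - a)) * cos (p - a)) (at p)"
      by (intro tendsto_intros v0 1 2 c)
    moreover have "\<forall>\<^sub>F t in at p. v t * ((v t / (t - p)) / (sin (t - a) / (t - p))) * cos (t - a) = G t"
      unfolding eventually_at_filter G_def cot_def by (auto simp: power2_eq_square)
    ultimately have "(G \<longlongrightarrow> v p * (v' p / cos (p - a)) * cos (p - a)) (at p)"
      using tendsto_cong by fastforce
    then show ?thesis using p by (simp add: isCont_def G_def)
  qed
  have contG: "continuous_on {a..a + pi} G"
  proof (rule continuous_at_imp_continuous_on, rule ballI)
    fix t assume "t \<in> {a..a + pi}"
    then consider "t = a" | "t = a + pi" | "t \<in> {a<..<a + pi}" by force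
    then show "isCont G t"
    proof cases
      case 3
      then show ?thesis using dG has_vector_derivative_continuous by blast
    qed (auto intro!: lim simp: va vb)
  qed
  have gi: "(g has_integral 0) {a..a + pi}"
    using fundamental_theorem_of_calculus_interior[OF _ contG dG] va vb by (simp add: G_def)
  have i1: "(\<lambda>t. (v t)\<^sup>2) integrable_on {a..a + pi}"
    by (intro integrable_continuous_interval continuous_intros cv)
  have i2: "(\<lambda>t. (v' t)\<^sup>2) integrable_on {a..a + pi}"
    by (intro integrable_continuous_interval continuous_intros continuous_on_subset[OF cv']) auto
  have "((\<lambda>t. (v' t)\<^sup>2 - (v t)\<^sup>2 - g t) has_integral
      integral {a..a + pi} (\<lambda>t. (v' t)\<^sup>2) - integral {a..a + pi} (\<lambda>t. (v t)\<^sup>2) - 0) {a..a + pi}"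
    by (intro has_integral_diff gi integrable_integral i1 i2)
  \<comment> \<open>At the end points \<open>g\<close> is zero because \<open>v\<close> is, the
    quotient being \<open>0 / 0 = 0\<close>. In between, 1/sin^2 = cot^2 + 1 completes the
    square.\<close>
  moreover have "(v' t)\<^sup>2 - (v t)\<^sup>2 - g t \<ge> 0" if "t \<in> {a..a + pi}" for t
  proof -
    consider "t = a" | "t = a + pi" | "t \<in> {a<..<a + pi}" using \<open>t \<in> {a..a + pi}\<close> by force
    then show ?thesis
    proof cases
      case 3
      have "(v t)\<^sup>2 / (sin (t - a))\<^sup>2 = (v t)\<^sup>2 * (cot (t - a))\<^sup>2 + (v t)\<^sup>2"
      proof -
        have E: "1 / (sin (t - a))\<^sup>2 = (cot (t - a))\<^sup>2 + 1"
          using sin0[OF 3] sin_cos_squared_add[of "t - a"] by (simp add: cot_def power_divide divide_simps)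
        have "(v t)\<^sup>2 / (sin (t - a))\<^sup>2 = (v t)\<^sup>2 * (1 / (sin (t - a))\<^sup>2)" by simp
        also have "\<dots> = (v t)\<^sup>2 * (cot (t - a))\<^sup>2 + (v t)\<^sup>2"
          by (simp only: E distrib_left mult_1_right)
        finally show ?thesis .
      qed
      moreover have "y\<^sup>2 - x\<^sup>2 - (2 * x * y * c - q) = (y - x * c)\<^sup>2" if "q = x\<^sup>2 * c\<^sup>2 + x\<^sup>2" for x y c q :: real
        unfolding that by (simp add: power2_eq_square algebra_simps)
      ultimately have "(v' t)\<^sup>2 - (v t)\<^sup>2 - g t = (v' t - v t * cot (t - a))\<^sup>2"
        unfolding g_def by blast
      then show ?thesis by simp
    qed (auto simp: g_def va vb)
  qed
  ultimately have "0 \<le> integral {a..a + pi} (\<lambda>t. (v' t)\<^sup>2) - integral {a..a + pi} (\<lambda>t. (v t)\<^sup>2) - 0"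
    by (rule has_integral_nonneg)
  then show ?thesis by simp
qed

lemma integral_periodic_shift:
  fixes g :: "real \<Rightarrow> real"
  assumes per: "\<And>t. g (t + p) = g t" and cg: "continuous_on UNIV g" and "0 \<le> a" "a \<le> p"
  shows "integral {a..a + p} g = integral {0..p} g"
proof -
  have int: "g integrable_on {x..y}" for x y
    by (intro integrable_continuous_interval continuous_on_subset[OF cg]) auto
  have "integral {0..a} g = integral {p..a + p} g"
  proof -
    have "(g has_integral integral {p..a + p} g) (cbox p (a + p))"
      using int by (simp add: integrable_integral)
    from has_integral_affinity[OF this, of 1 p] have "((\<lambda>x. g (x + p)) has_integral integral {p..a + p} g) {0..a}"
      by (simp add: image_diff_atLeastAtMost)
    then show ?thesis by (simp add: per integral_unique)
  qed
  moreover have "integral {0..a} g + integral {a..p} g = integral {0..p} g"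
    using assms by (intro Henstock_Kurzweil_Integration.integral_combine int) auto
  moreover have "integral {a..p} g + integral {p..a + p} g = integral {a..a + p} g"
    using assms by (intro Henstock_Kurzweil_Integration.integral_combine int) auto
  ultimately show ?thesis by linarith
qed

lemma periodic_deriv:
  fixes y y' :: "real \<Rightarrow> real"
  assumes dy: "\<And>t. (y has_real_derivative y' t) (at t)" and per: "\<And>t. y (t + p) = y t"
  shows "y' (t + p) = y' t"
proof -
  have "((\<lambda>t. y (t + p)) has_real_derivative y' (t + p)) (at t)"
    using dy[of "t + p"] by (simp add: DERIV_shift)
  then show ?thesis using dy[of t] per DERIV_unique by force
qed

text \<open>The mean value of \<open>y\<close> would be the classical choice of \<open>c\<close>.
  Any constant serves in \<open>hurwitz\<close>, since it is paired there with a derivative of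
  integral zero; this allows a choice that needs no Fourier series.\<close>

lemma wirtinger_periodic:
  fixes y y' :: "real \<Rightarrow> real"
  assumes dy: "\<And>t. (y has_real_derivative y' t) (at t)" and cy': "continuous_on UNIV y'"
    and per: "\<And>t. y (t + 2 * pi) = y t"
  obtains c where "integral {0..2 * pi} (\<lambda>t. (y t - c)\<^sup>2) \<le> integral {0..2 * pi} (\<lambda>t. (y' t)\<^sup>2)"
proof -
  have cy: "continuous_on S y" for S
    using dy by (meson DERIV_continuous_on DERIV_subset subset_UNIV)
  \<comment> \<open>Subtracting the common value at two antipodal points reduces to two half circles.\<close>
  define d where "d t = y t - y (t + pi)" for t
  have cd: "continuous_on {0..pi} d"
    unfolding d_def by (intro continuous_intros continuous_on_compose2[OF cy]) auto
  \<comment> \<open>By periodicity \<open>d\<close> takes opposite values at the ends, so the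
    intermediate value theorem yields a pair of antipodal points with equal values.\<close>
  have "d pi = - d 0" using per[of 0] by (simp add: d_def)
  then have "\<exists>t\<in>{0..pi}. d t = 0"
    using IVT'[of d 0 0 pi] IVT2'[of d pi 0 0] cd
    by (cases "d 0 \<le> 0") (simp_all add: Bex_def)
  then obtain a where a: "0 \<le> a" "a \<le> pi" "y a = y (a + pi)" by (auto simp: d_def)
  define c where "c = y a"
  have dv: "((\<lambda>t. y t - c) has_real_derivative y' t) (at t)" for t
    using dy by (auto intro!: derivative_eq_intros)
  have i1: "(\<lambda>t. (y t - c)\<^sup>2) integrable_on {x..z}" for x z
    by (intro integrable_continuous_interval continuous_intros cy)
  have i2: "(\<lambda>t. (y' t)\<^sup>2) integrable_on {x..z}" for x z
    by (intro integrable_continuous_interval continuous_intros continuous_on_subset[OF cy']) auto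
  have "integral {0..2 * pi} (\<lambda>t. (y t - c)\<^sup>2) = integral {a..a + 2 * pi} (\<lambda>t. (y t - c)\<^sup>2)"
    using a by (intro integral_periodic_shift[symmetric]) (auto simp: per intro!: continuous_intros cy)
  also have "\<dots> = integral {a..a + pi} (\<lambda>t. (y t - c)\<^sup>2) + integral {a + pi..(a + pi) + pi} (\<lambda>t. (y t - c)\<^sup>2)"
    by (subst Henstock_Kurzweil_Integration.integral_combine[OF _ _ i1]) (auto simp: algebra_simps)
  also have "\<dots> \<le> integral {a..a + pi} (\<lambda>t. (y' t)\<^sup>2) + integral {a + pi..(a + pi) + pi} (\<lambda>t. (y' t)\<^sup>2)"
  proof (intro add_mono wirtinger_interval[OF dv cy'])
    show "y a - c = 0" by (simp add: c_def)
    show "y (a + pi) - c = 0" "y (a + pi) - c = 0" by (simp_all only: c_def a(3)[symmetric] diff_self)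
    have "a + pi + pi = a + 2 * pi" by simp
    then show "y (a + pi + pi) - c = 0" by (simp only: per c_def diff_self)
  qed
  also have "\<dots> = integral {a..a + 2 * pi} (\<lambda>t. (y' t)\<^sup>2)"
    by (subst Henstock_Kurzweil_Integration.integral_combine[OF _ _ i2]) (auto simp: algebra_simps)
  also have "\<dots> = integral {0..2 * pi} (\<lambda>t. (y' t)\<^sup>2)"
    using a(1,2) periodic_deriv[OF dy per]
    by (intro integral_periodic_shift) (auto intro!: continuous_intros cy')
  finally show ?thesis using that by blast
qed

lemma integral_by_parts_periodic:
  fixes f h f' h' :: "real \<Rightarrow> real"
  assumes df: "\<And>t. (f has_real_derivative f' t) (at t)" and cf': "continuous_on UNIV f'"
    and dh: "\<And>t. (h has_real_derivative h' t) (at t)" and ch': "continuous_on UNIV h'"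
    and per: "f p = f 0" "h p = h 0" and p: "0 \<le> p"
  shows "integral {0..p} (\<lambda>t. f t * h' t) = - integral {0..p} (\<lambda>t. f' t * h t)"
proof -
  have cf: "continuous_on S f" and ch: "continuous_on S h" for S
    using df dh by (meson DERIV_continuous_on DERIV_subset subset_UNIV)+
  have c': "continuous_on S f'" "continuous_on S h'" for S
    using cf' ch' continuous_on_subset by blast+
  have "((\<lambda>t. f t * h' t + f' t * h t) has_integral (f p * h p - f 0 * h 0)) {0..p}"
    by (rule fundamental_theorem_of_calculus[OF p])
       (auto intro!: derivative_eq_intros DERIV_subset[OF df] DERIV_subset[OF dh]
         simp: has_real_derivative_iff_has_vector_derivative[symmetric])
  then have "integral {0..p} (\<lambda>t. f t * h' t + f' t * h t) = 0" using per by (simp add: integral_unique)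
  moreover have "integral {0..p} (\<lambda>t. f t * h' t + f' t * h t)
      = integral {0..p} (\<lambda>t. f t * h' t) + integral {0..p} (\<lambda>t. f' t * h t)"
    by (intro Henstock_Kurzweil_Integration.integral_add integrable_continuous_interval continuous_intros cf ch c')
  ultimately show ?thesis by linarith
qed

lemma continuous_integral_eq_0:
  fixes g :: "real \<Rightarrow> real"
  assumes "continuous_on {a..b} g" "\<And>t. t \<in> {a..b} \<Longrightarrow> 0 \<le> g t" "integral {a..b} g = 0" "a < b" "t \<in> {a..b}"
  shows "g t = 0"
  using has_integral_0_cbox_imp_0[of a b g t] assms integrable_integral[OF integrable_continuous_interval[OF assms(1)]]
  by auto

text \<open>The isoperimetric inequality for the closed curve \<open>(f, h)\<close>, in Hurwitz's form.\<close>
lemma hurwitz: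
  fixes f h f' h' :: "real \<Rightarrow> real"
  assumes df: "\<And>t. (f has_real_derivative f' t) (at t)" and cf': "continuous_on UNIV f'"
    and dh: "\<And>t. (h has_real_derivative h' t) (at t)" and ch': "continuous_on UNIV h'"
    and pf: "\<And>t. f (t + 2 * pi) = f t" and ph: "\<And>t. h (t + 2 * pi) = h t"
  shows "0 \<le> integral {0..2 * pi} (\<lambda>t. (f' t)\<^sup>2 + (h' t)\<^sup>2 - 2 * (f t * h' t))"
    and "integral {0..2 * pi} (\<lambda>t. (f' t)\<^sup>2 + (h' t)\<^sup>2 - 2 * (f t * h' t)) = 0
      \<Longrightarrow> \<exists>c. \<forall>t\<in>{0..2 * pi}. h' t = f t - c"
proof -
  have cf: "continuous_on S f" and ch: "continuous_on S h" for S
    using df dh by (meson DERIV_continuous_on DERIV_subset subset_UNIV)+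
  have c': "continuous_on S f'" "continuous_on S h'" for S
    using cf' ch' continuous_on_subset by blast+
  obtain c where c: "integral {0..2 * pi} (\<lambda>t. (f t - c)\<^sup>2) \<le> integral {0..2 * pi} (\<lambda>t. (f' t)\<^sup>2)"
    using wirtinger_periodic[OF df cf' pf] by blast
  \<comment> \<open>Integration by parts against the constant function \<open>c\<close>, whose
    derivative is 0.\<close>
  have "integral {0..2 * pi} (\<lambda>t. c * h' t) = - integral {0..2 * pi} (\<lambda>t. 0 * h t)"
    using ph[of 0] by (intro integral_by_parts_periodic dh ch') auto
  then have z: "integral {0..2 * pi} (\<lambda>t. c * h' t) = 0" by simp
  have i: "(\<lambda>t. (f t - c)\<^sup>2) integrable_on {0..2 * pi}" "(\<lambda>t. (f' t)\<^sup>2) integrable_on {0..2 * pi}"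
    "(\<lambda>t. c * h' t) integrable_on {0..2 * pi}" "(\<lambda>t. (f t - c - h' t)\<^sup>2) integrable_on {0..2 * pi}"
    by (intro integrable_continuous_interval continuous_intros cf c')+
  \<comment> \<open>The deficit is rewritten as a square, plus the Wirtinger difference of
    \<open>f\<close>, plus a multiple of \<open>h'\<close> with integral zero. If it vanishes, so
    does the square, which is the equation \<open>h' = f - c\<close>.\<close>
  have "((\<lambda>t. (f t - c - h' t)\<^sup>2 + (f' t)\<^sup>2 - (f t - c)\<^sup>2 - 2 * (c * h' t)) has_integral
     (integral {0..2 * pi} (\<lambda>t. (f t - c - h' t)\<^sup>2) + integral {0..2 * pi} (\<lambda>t. (f' t)\<^sup>2)
      - integral {0..2 * pi} (\<lambda>t. (f t - c)\<^sup>2) - 2 * integral {0..2 * pi} (\<lambda>t. c * h' t))) {0..2 * pi}"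
    by (intro has_integral_diff has_integral_add has_integral_mult_right integrable_integral i)
  moreover have "(\<lambda>t. (f t - c - h' t)\<^sup>2 + (f' t)\<^sup>2 - (f t - c)\<^sup>2 - 2 * (c * h' t))
      = (\<lambda>t. (f' t)\<^sup>2 + (h' t)\<^sup>2 - 2 * (f t * h' t))"
    by (auto simp: power2_eq_square algebra_simps)
  ultimately have eq: "integral {0..2 * pi} (\<lambda>t. (f' t)\<^sup>2 + (h' t)\<^sup>2 - 2 * (f t * h' t)) =
     integral {0..2 * pi} (\<lambda>t. (f t - c - h' t)\<^sup>2) + integral {0..2 * pi} (\<lambda>t. (f' t)\<^sup>2)
      - integral {0..2 * pi} (\<lambda>t. (f t - c)\<^sup>2)"
    using z by (simp add: integral_unique)
  have nn: "0 \<le> integral {0..2 * pi} (\<lambda>t. (f t - c - h' t)\<^sup>2)"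
    by (intro Henstock_Kurzweil_Integration.integral_nonneg i) auto
  show "0 \<le> integral {0..2 * pi} (\<lambda>t. (f' t)\<^sup>2 + (h' t)\<^sup>2 - 2 * (f t * h' t))"
    using eq nn c by linarith
  assume "integral {0..2 * pi} (\<lambda>t. (f' t)\<^sup>2 + (h' t)\<^sup>2 - 2 * (f t * h' t)) = 0"
  then have "integral {0..2 * pi} (\<lambda>t. (f t - c - h' t)\<^sup>2) = 0" using eq nn c by linarith
  then have "(f t - c - h' t)\<^sup>2 = 0" if "t \<in> {0..2 * pi}" for t
    using that by (intro continuous_integral_eq_0[of 0 "2 * pi" "\<lambda>t. (f t - c - h' t)\<^sup>2"])
       (auto intro!: continuous_intros cf c')
  then show "\<exists>c. \<forall>t\<in>{0..2 * pi}. h' t = f t - c" by (intro exI[of _ c]) auto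
qed

section \<open>Integration over the sphere\<close>

lemma spherical_nth [simp]:
  "spherical \<theta> \<psi> $ 1 = sin \<theta> * cos \<psi>" "spherical \<theta> \<psi> $ 2 = sin \<theta> * sin \<psi>" "spherical \<theta> \<psi> $ 3 = cos \<theta>"
  by (simp_all add: spherical_def)

lemma norm_spherical [simp]: "norm (spherical \<theta> \<psi>) = 1"
proof -
  have "(sin \<theta> * cos \<psi>)\<^sup>2 + (sin \<theta> * sin \<psi>)\<^sup>2 + (cos \<theta>)\<^sup>2 = 1"
    by (simp add: power_mult_distrib flip: distrib_left)
  then show ?thesis
    by (simp add: norm_eq_1 inner_vec_def sum_3 power2_eq_square)
qed

lemma S2_eq_spherical:
  assumes "x \<in> S2"
  obtains \<theta> \<psi> where "\<theta> \<in> {0..pi}" "0 \<le> \<psi>" "\<psi> < 2 * pi" "x = spherical \<theta> \<psi>"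
proof -
  have n: "(x $ 1)\<^sup>2 + (x $ 2)\<^sup>2 + (x $ 3)\<^sup>2 = 1"
    using assms by (simp add: norm_eq_1 inner_vec_def sum_3 power2_eq_square)
  then have "(x $ 3)\<^sup>2 \<le> 1"
    using sum_power2_ge_zero[of "x $ 1" "x $ 2"] by linarith
  then have "\<bar>x $ 3\<bar> \<le> 1" by (simp add: abs_square_le_1)
  then have z: "-1 \<le> x $ 3" "x $ 3 \<le> 1" by auto
  define \<theta> where "\<theta> = arccos (x $ 3)"
  have t: "\<theta> \<in> {0..pi}" "cos \<theta> = x $ 3" using z by (auto simp: \<theta>_def arccos_lbound arccos_ubound)
  have s: "(sin \<theta>)\<^sup>2 = (x $ 1)\<^sup>2 + (x $ 2)\<^sup>2" using n t by (simp add: sin_squared_eq)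
  have "\<exists>\<psi>. 0 \<le> \<psi> \<and> \<psi> < 2 * pi \<and> x $ 1 = sin \<theta> * cos \<psi> \<and> x $ 2 = sin \<theta> * sin \<psi>"
  proof (cases "sin \<theta> = 0")
    case True
    then have "x $ 1 = 0 \<and> x $ 2 = 0" using s by (simp add: sum_power2_eq_zero_iff)
    \<comment> \<open>At a pole every longitude represents the point; 0 is picked.\<close>
    then show ?thesis using True by (intro exI[of _ 0]) auto
  next
    case False
    have "(x $ 1 / sin \<theta>)\<^sup>2 + (x $ 2 / sin \<theta>)\<^sup>2 = 1"
      unfolding power_divide add_divide_distrib[symmetric] s[symmetric] using False by simp
    from sincos_total_2pi[OF this] obtain \<psi> where
      p: "0 \<le> \<psi>" "\<psi> < 2 * pi" "x $ 1 / sin \<theta> = cos \<psi>" "x $ 2 / sin \<theta> = sin \<psi>" .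
    then show ?thesis using False by (intro exI[of _ \<psi>]) (auto simp: field_simps)
  qed
  then obtain \<psi> where "0 \<le> \<psi>" "\<psi> < 2 * pi" "x $ 1 = sin \<theta> * cos \<psi>" "x $ 2 = sin \<theta> * sin \<psi>" by blast
  then show ?thesis using t that[of \<theta> \<psi>] by (simp add: vec_eq_iff forall_3)
qed

lemma continuous_on_spherical [continuous_intros]:
  fixes a b :: "'a::t2_space \<Rightarrow> real"
  assumes "continuous_on S a" "continuous_on S b"
  shows "continuous_on S (\<lambda>x. spherical (a x) (b x))"
proof -
  have "spherical s t = (\<chi> i. if i = 1 then sin s * cos t else if i = 2 then sin s * sin t else cos s)" for s t
    by (simp add: vec_eq_iff forall_3)
  moreover have "continuous_on S (\<lambda>x. if i = (1::3) then sin (a x) * cos (b x)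
      else if i = 2 then sin (a x) * sin (b x) else cos (a x))" for i
    using assms by (cases "i = 1"; cases "i = 2")
      (auto intro!: continuous_intros)
  ultimately show ?thesis by (simp add: continuous_on_vec_lambda)
qed

lemma continuous_on_S2_spherical:
  fixes k :: "real^3 \<Rightarrow> 'a::topological_space" and a b :: "'b::t2_space \<Rightarrow> real"
  assumes "continuous_on S2 k" "continuous_on S a" "continuous_on S b"
  shows "continuous_on S (\<lambda>x. k (spherical (a x) (b x)))"
  by (rule continuous_on_compose2[OF assms(1)]) (auto intro!: continuous_intros assms)

text \<open>Unfolds the push-forward and the density, which is sin \<theta> by
  \<open>area_density_eq\<close>. As the resulting integrand is continuous on the closed rectangle,
  the boundary can be added and the integral iterated.\<close>

lemma integral_area_S2:
  fixes k :: "real^3 \<Rightarrow> real"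
  assumes k: "continuous_on S2 k"
  shows "(\<integral>x. k x \<partial>area_S2) = integral {0..pi} (\<lambda>\<theta>. integral {0..2 * pi} (\<lambda>\<psi>. sin \<theta> * k (spherical \<theta> \<psi>)))"
proof -
  let ?D = "{0<..<pi} \<times> {0<..<2 * pi}"
  let ?s = "\<lambda>(\<theta>, \<psi>). spherical \<theta> \<psi>"
  let ?F = "\<lambda>z. sin (fst z) * k (spherical (fst z) (snd z))"
  define M where "M = restrict_space lborel ?D"
  have D: "?D = box (0, 0) (pi, 2 * pi)" by (auto simp: box_def Basis_prod_def)
  have cF: "continuous_on S ?F" for S
    by (intro continuous_intros continuous_on_S2_spherical[OF k])
  have mk: "k \<in> borel_measurable (restrict_space borel S2)"
    using k by (rule borel_measurable_continuous_on_restrict)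
  have ms: "?s \<in> M \<rightarrow>\<^sub>M restrict_space borel S2"
  proof (rule measurable_restrict_space2)
    have "?s \<in> borel \<rightarrow>\<^sub>M borel"
      by (intro borel_measurable_continuous_onI) (auto simp: case_prod_unfold intro!: continuous_intros)
    then show "?s \<in> M \<rightarrow>\<^sub>M borel"
      unfolding M_def by (intro measurable_restrict_space1) simp
  qed auto
  have sin_m: "(\<lambda>z. sin (fst z)) \<in> borel_measurable M"
  proof -
    have "(\<lambda>z :: real \<times> real. sin (fst z)) \<in> borel \<rightarrow>\<^sub>M borel"
      by (intro borel_measurable_continuous_onI continuous_intros)
    then show ?thesis
      unfolding M_def by (intro measurable_restrict_space1) simp
  qed
  have area: "area_S2 = distr (density M (\<lambda>z. ennreal (sin (fst z)))) (restrict_space borel S2) ?s"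
  proof -
    have "density M (\<lambda>z. ennreal (sin (fst z))) = density M (\<lambda>(\<theta>, \<psi>). ennreal (area_density \<theta> \<psi>))"
    proof (rule density_cong)
      show sm: "(\<lambda>z. ennreal (sin (fst z))) \<in> borel_measurable M"
        using sin_m by simp
      have eq: "(\<lambda>(\<theta>, \<psi>). ennreal (area_density \<theta> \<psi>)) z = ennreal (sin (fst z))" if "z \<in> space M" for z
        using that area_density_eq by (auto simp: M_def space_restrict_space)
      \<comment> \<open>The density is a square root of vector derivatives; its measurability is
        read off from its agreement with the sine on the rectangle.\<close>
      show "(\<lambda>(\<theta>, \<psi>). ennreal (area_density \<theta> \<psi>)) \<in> borel_measurable M"
        using sm eq by (subst measurable_cong) auto
      show "AE z in M. ennreal (sin (fst z)) = (\<lambda>(\<theta>, \<psi>). ennreal (area_density \<theta> \<psi>)) z"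
        using eq by auto
    qed
    then show ?thesis by (simp add: area_S2_def M_def)
  qed
  have "(\<integral>x. k x \<partial>area_S2) = (\<integral>z. k (?s z) \<partial>density M (\<lambda>z. ennreal (sin (fst z))))"
    unfolding area using ms mk by (intro integral_distr) auto
  also have "\<dots> = (\<integral>z. sin (fst z) *\<^sub>R k (?s z) \<partial>M)"
  proof (rule integral_density)
    show "(\<lambda>z. k (?s z)) \<in> borel_measurable M" using measurable_compose[OF ms mk] by simp
    show "(\<lambda>z. sin (fst z)) \<in> borel_measurable M"
      using sin_m by (simp add: M_def)
    show "AE z in M. 0 \<le> sin (fst z)"
      by (intro AE_I2) (auto simp: M_def space_restrict_space intro!: sin_ge_zero)
  qed
  also have "\<dots> = (\<integral>z. ?F z \<partial>M)" by (simp add: case_prod_unfold)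
  also have "\<dots> = (LINT z : ?D | lborel. ?F z)"
    unfolding M_def set_lebesgue_integral_def
    by (subst integral_restrict_space) (auto simp: D)
  also have "\<dots> = integral ?D ?F"
  proof (rule set_borel_integral_eq_integral)
    have "set_integrable lborel (cbox (0, 0) (pi, 2 * pi)) ?F"
      unfolding set_integrable_def by (rule borel_integrable_compact[OF compact_cbox cF])
    then show "set_integrable lborel ?D ?F"
      by (rule set_integrable_subset) (auto simp: D box_subset_cbox)
  qed
  also have "\<dots> = integral (cbox (0, 0) (pi, 2 * pi)) ?F"
    unfolding D by (rule integral_open_interval)
  also have "\<dots> = integral {0..pi} (\<lambda>\<theta>. integral {0..2 * pi} (\<lambda>\<psi>. sin \<theta> * k (spherical \<theta> \<psi>)))"
    using integral_prod_continuous[OF cF, of 0 0 pi "2 * pi"] by (simp only: fst_conv snd_conv box_real)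
  finally show ?thesis .
qed

section \<open>Polar coordinates in the unit ball\<close>

text \<open>\<open>has_absolute_integral_change_of_variables\<close> concerns functions with values
  in \<open>real^'n\<close>; scalars are passed through \<open>real^1\<close> by
  \<open>vec\<close>.\<close>

lemma integral_change_of_variables_to_real:
  fixes f :: "real^'m::{finite,wellorder} \<Rightarrow> real" and g :: "real^'m::_ \<Rightarrow> real^'m::_"
  assumes S: "S \<in> sets lebesgue"
    and der_g: "\<And>x. x \<in> S \<Longrightarrow> (g has_derivative g' x) (at x within S)"
    and inj: "inj_on g S"
    and int: "(\<lambda>x. \<bar>det (matrix (g' x))\<bar> * f (g x)) absolutely_integrable_on S"
  shows "f absolutely_integrable_on (g ` S)"
    and "integral (g ` S) f = integral S (\<lambda>x. \<bar>det (matrix (g' x))\<bar> * f (g x))"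
proof -
  let ?f = "\<lambda>x. vec (f x) :: real^1" and ?h = "\<lambda>x. \<bar>det (matrix (g' x))\<bar> *\<^sub>R (vec (f (g x)) :: real^1)"
  have "?h absolutely_integrable_on S" using int by (simp add: absolutely_integrable_on_1_iff)
  with has_absolute_integral_change_of_variables[OF S der_g inj, of ?f "integral S ?h"]
  have "?f absolutely_integrable_on (g ` S)" and *: "integral (g ` S) ?f = integral S ?h" by blast+
  then show "f absolutely_integrable_on (g ` S)" by (simp add: absolutely_integrable_on_1_iff)
  have "integral (g ` S) ?f $ 1 = integral S ?h $ 1" using * by simp
  then show "integral (g ` S) f = integral S (\<lambda>x. \<bar>det (matrix (g' x))\<bar> * f (g x))"
    by (simp add: integral_on_1_eq flip: vec_eq_iff)
qed

lemma continuous_on_vec3: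
  "continuous_on S (\<lambda>(r, \<theta>, \<psi>). vector [r, \<theta>, \<psi>] :: real^3)"
proof -
  have "vector [r, s, t] = ((\<chi> i. if i = 1 then r else if i = 2 then s else t) :: real^3)" for r s t :: real
    by (simp add: vec_eq_iff forall_3)
  moreover have "continuous_on S (\<lambda>z :: real \<times> real \<times> real. if i = (1::3) then fst z
      else if i = 2 then fst (snd z) else snd (snd z))" for i
    by (cases "i = 1"; cases "i = 2") (auto intro!: continuous_intros)
  ultimately show ?thesis by (simp add: case_prod_unfold continuous_on_vec_lambda)
qed

lemma measurable_vec3: "(\<lambda>(r, \<theta>, \<psi>). vector [r, \<theta>, \<psi>] :: real^3) \<in> lborel \<rightarrow>\<^sub>M borel"
  using borel_measurable_continuous_onI[OF continuous_on_vec3] by simp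

text \<open>Links the two models of space: the change of variables lives on \<open>real^3\<close>,
  iterated integration on \<open>real \<times> real \<times> real\<close>. Both Lebesgue measures
  give a box the product of its side lengths, and this determines them.\<close>

lemma lborel_vec3:
  "(lborel :: (real^3) measure) = distr lborel borel (\<lambda>(r, \<theta>, \<psi>). vector [r, \<theta>, \<psi>])"
proof (rule lborel_eqI)
  let ?V = "\<lambda>(r, \<theta>, \<psi>). vector [r, \<theta>, \<psi>] :: real^3"
  fix l u :: "real^3"
  assume "\<And>b. b \<in> Basis \<Longrightarrow> l \<bullet> b \<le> u \<bullet> b"
  then have le: "l $ i \<le> u $ i" for i
    by (metis axis_in_Basis_iff Basis_real_def cart_eq_inner_axis singletonI)
  have "?V -` box l u = box (l $ 1, l $ 2, l $ 3) (u $ 1, u $ 2, u $ 3)"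
    by (auto simp: box_def Basis_vec_def Basis_prod_def inner_axis forall_3)
  then have "emeasure (distr lborel borel ?V) (box l u)
      = emeasure lborel (box (l $ 1, l $ 2, l $ 3) (u $ 1, u $ 2, u $ 3))"
    using measurable_vec3 by (simp add: emeasure_distr)
  also have "\<dots> = ennreal ((u $ 1 - l $ 1) * ((u $ 2 - l $ 2) * (u $ 3 - l $ 3)))"
    using le by (subst emeasure_lborel_box)
      (auto simp: Basis_prod_def prod.union_disjoint prod.insert_if)
  also have "\<dots> = ennreal (\<Prod>b\<in>Basis. (u - l) \<bullet> b)"
  proof -
    have B: "(Basis :: (real^3) set) = range (\<lambda>i. axis i 1)" by (auto simp: Basis_vec_def)
    have inj: "inj (\<lambda>i :: 3. axis i (1 :: real))" by (auto simp: inj_on_def axis_eq_axis)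
    have "(\<Prod>b\<in>Basis. (u - l) \<bullet> b) = (\<Prod>i\<in>UNIV. (u - l) $ i)"
      unfolding B prod.reindex[OF inj] by (simp add: inner_axis)
    also have "\<dots> = (u $ 1 - l $ 1) * ((u $ 2 - l $ 2) * (u $ 3 - l $ 3))"
      unfolding UNIV_3 by simp
    finally show ?thesis by simp
  qed
  finally show "emeasure (distr lborel borel ?V) (box l u) = ennreal (\<Prod>b\<in>Basis. (u - l) \<bullet> b)" .
qed simp

definition e\<^sub>\<theta> :: "real \<Rightarrow> real \<Rightarrow> real^3" where
  "e\<^sub>\<theta> \<theta> \<psi> = vector [cos \<theta> * cos \<psi>, cos \<theta> * sin \<psi>, - sin \<theta>]"

text \<open>The \<psi>-derivative of \<open>spherical\<close> divided by sin \<theta>. With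
  \<open>spherical\<close> and \<open>e\<^sub>\<theta>\<close> it forms an orthonormal frame for all
  angles, the poles included.\<close>

definition e\<^sub>\<psi> :: "real \<Rightarrow> real^3" where
  "e\<^sub>\<psi> \<psi> = vector [- sin \<psi>, cos \<psi>, 0]"

lemma has_derivative_spherical:
  assumes a: "(a has_derivative a') (at x within S)" and b: "(b has_derivative b') (at x within S)"
  shows "((\<lambda>x. spherical (a x) (b x)) has_derivative
    (\<lambda>h. a' h *\<^sub>R e\<^sub>\<theta> (a x) (b x) + (sin (a x) * b' h) *\<^sub>R e\<^sub>\<psi> (b x))) (at x within S)"
proof -
  let ?e = "\<lambda>k. axis k 1 :: real^3"
  have sph: "spherical s t = (sin s * cos t) *\<^sub>R ?e 1 + (sin s * sin t) *\<^sub>R ?e 2 + cos s *\<^sub>R ?e 3" for s t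
    by (simp add: vec_eq_iff forall_3 axis_def)
  have et: "e\<^sub>\<theta> s t = (cos s * cos t) *\<^sub>R ?e 1 + (cos s * sin t) *\<^sub>R ?e 2 + (- sin s) *\<^sub>R ?e 3" for s t
    by (simp add: vec_eq_iff forall_3 axis_def e\<^sub>\<theta>_def)
  have ep: "e\<^sub>\<psi> t = (- sin t) *\<^sub>R ?e 1 + cos t *\<^sub>R ?e 2" for t
    by (simp add: vec_eq_iff forall_3 axis_def e\<^sub>\<psi>_def)
  show ?thesis
    unfolding sph et ep
    by (rule derivative_eq_intros a b refl)+ (auto simp: algebra_simps)
qed

text \<open>A point of the open ball with nonzero second coordinate has sin \<theta> and sin \<psi>
  nonzero, hence polar coordinates in the open box. The missed points thus lie in a plane or on the
  unit sphere.\<close>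

lemma negligible_cball_minus_polar_box:
  "negligible (cball (0::real^3) 1 - (\<lambda>x::real^3. x $ 1 *\<^sub>R spherical (x $ 2) (x $ 3)) `
     box (vector [0, 0, 0]) (vector [1, pi, 2 * pi]))"
proof (rule negligible_subset)
  show "negligible ({x :: real^3. x $ 2 = 0} \<union> sphere 0 1)"
    by (intro negligible_Un negligible_standard_hyperplane_cart negligible_sphere)
  let ?g = "\<lambda>x :: real^3. x $ 1 *\<^sub>R spherical (x $ 2) (x $ 3)"
  show "cball (0::real^3) 1 - ?g ` box (vector [0, 0, 0]) (vector [1, pi, 2 * pi])
    \<subseteq> {x. x $ 2 = 0} \<union> sphere 0 1"
  proof (intro subsetI, rule ccontr)
    fix x :: "real^3"
    assume "x \<in> cball 0 1 - ?g ` box (vector [0, 0, 0]) (vector [1, pi, 2 * pi])"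
      and "x \<notin> {x. x $ 2 = 0} \<union> sphere 0 1"
    then have x: "norm x \<le> 1" "x $ 2 \<noteq> 0" "norm x \<noteq> 1"
      "x \<notin> ?g ` box (vector [0, 0, 0]) (vector [1, pi, 2 * pi])"
      by simp_all
    define r where "r = norm x"
    have r: "0 < r" "r < 1" using x by (cases "x = 0"; simp add: r_def)+
    have "x /\<^sub>R r \<in> S2" using r by (simp add: r_def)
    then obtain \<theta> \<psi> where t: "\<theta> \<in> {0..pi}" "0 \<le> \<psi>" "\<psi> < 2 * pi" "x /\<^sub>R r = spherical \<theta> \<psi>"
      using S2_eq_spherical by blast
    have x_eq: "x = r *\<^sub>R spherical \<theta> \<psi>" using r by (simp flip: t(4))
    have "sin \<theta> \<noteq> 0" "sin \<psi> \<noteq> 0" using x(2) unfolding x_eq by auto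
    then have "\<theta> \<noteq> 0" "\<theta> \<noteq> pi" "\<psi> \<noteq> 0" by auto
    then have "vector [r, \<theta>, \<psi>] \<in> box (vector [0, 0, 0]) (vector [1, pi, 2 * pi] :: real^3)"
      using t r by (auto simp: mem_box_cart forall_3)
    then have "?g (vector [r, \<theta>, \<psi>]) \<in> ?g ` box (vector [0, 0, 0]) (vector [1, pi, 2 * pi])"
      by (rule imageI)
    then show False using x(4) x_eq by simp
  qed
qed

lemma inj_on_polar:
  "inj_on (\<lambda>x::real^3. x $ 1 *\<^sub>R spherical (x $ 2) (x $ 3)) (box (vector [0, 0, 0]) (vector [1, pi, 2 * pi]))"
proof (rule inj_onI)
  fix x y :: "real^3"
  assume x: "x \<in> box (vector [0, 0, 0]) (vector [1, pi, 2 * pi])"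
    and y: "y \<in> box (vector [0, 0, 0]) (vector [1, pi, 2 * pi])"
    and eq: "x $ 1 *\<^sub>R spherical (x $ 2) (x $ 3) = y $ 1 *\<^sub>R spherical (y $ 2) (y $ 3)"
  have X: "0 < x $ 1" "0 < x $ 2" "x $ 2 < pi" "0 < x $ 3" "x $ 3 < 2 * pi"
    and Y: "0 < y $ 1" "0 < y $ 2" "y $ 2 < pi" "0 < y $ 3" "y $ 3 < 2 * pi"
    using x y by (auto simp: mem_box_cart forall_3)
  have 1: "x $ 1 = y $ 1" using arg_cong[OF eq, of norm] X Y by simp
  then have s: "spherical (x $ 2) (x $ 3) = spherical (y $ 2) (y $ 3)" using eq X by simp
  have 2: "x $ 2 = y $ 2"
    using arg_cong[OF s, of "\<lambda>v. v $ 3"] X Y by (auto intro: cos_inj_pi)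
  moreover have "sin (x $ 2) > 0" using X by (intro sin_gt_zero) auto
  ultimately have "cos (x $ 3) = cos (y $ 3)" "sin (x $ 3) = sin (y $ 3)"
    using arg_cong[OF s, of "\<lambda>v. v $ 1"] arg_cong[OF s, of "\<lambda>v. v $ 2"] by auto
  then obtain n :: int where n: "x $ 3 = y $ 3 + 2 * pi * of_int n"
    using sin_cos_eq_iff[of "x $ 3" "y $ 3"] by auto
  have "2 * pi * of_int n < 2 * pi * 1" "2 * pi * (-1) < 2 * pi * of_int n"
    using n X Y by linarith+
  moreover have "0 < 2 * pi" by simp
  ultimately have "of_int n < (1 :: real)" "(-1 :: real) < of_int n"
    by (metis mult_less_cancel_left_pos)+
  then have "n = 0" by linarith
  then show "x = y" using 1 2 n by (simp add: vec_eq_iff forall_3)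
qed

text \<open>Moves a box integral to the product type, where \<open>integral_prod_continuous\<close>
  can split off the radius.\<close>

lemma integral_cbox3:
  fixes a b c :: "real"
  assumes H: "continuous_on UNIV (H :: real^3 \<Rightarrow> real)"
  shows "integral (cbox (vector [0, 0, 0]) (vector [a, b, c])) H =
    integral (cbox (0, 0, 0) (a, b, c)) (\<lambda>(r, \<theta>, \<psi>). H (vector [r, \<theta>, \<psi>]))"
proof -
  let ?C = "cbox (vector [0, 0, 0]) (vector [a, b, c]) :: (real^3) set"
  let ?V = "\<lambda>(r, \<theta>, \<psi>). vector [r, \<theta>, \<psi>] :: real^3"
  have 1: "set_integrable lborel ?C H"
    unfolding set_integrable_def by (rule borel_integrable_compact[OF compact_cbox]) (rule continuous_on_subset[OF H], simp)
  have 2: "set_integrable lborel (cbox (0, 0, 0) (a, b, c)) (\<lambda>z. H (?V z))"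
    unfolding set_integrable_def by (rule borel_integrable_compact[OF compact_cbox]) (rule continuous_on_compose2[OF H continuous_on_vec3], simp)
  have "integral ?C H = (LINT x : ?C | lborel. H x)"
    using set_borel_integral_eq_integral[OF 1] by simp
  also have "\<dots> = (\<integral>z. indicator ?C (?V z) *\<^sub>R H (?V z) \<partial>lborel)"
    unfolding set_lebesgue_integral_def
    by (subst lborel_vec3, rule integral_distr) (use measurable_vec3 borel_measurable_continuous_onI[OF H] in simp_all)
  also have "\<dots> = (LINT z : cbox (0, 0, 0) (a, b, c) | lborel. H (?V z))"
    unfolding set_lebesgue_integral_def
    by (intro Bochner_Integration.integral_cong refl arg_cong2[of _ _ _ _ "(*\<^sub>R)"])
       (auto simp: indicator_def mem_box_cart forall_3 cbox_Pair_eq)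
  also have "\<dots> = integral (cbox (0, 0, 0) (a, b, c)) (\<lambda>z. H (?V z))"
    by (rule set_borel_integral_eq_integral[OF 2])
  finally show ?thesis by (simp add: case_prod_unfold)
qed

text \<open>The area measure is defined by a chart with a distinguished axis. The integral over the
  ball of the extension that is constant along rays has no such axis; the factor is the integral of
  \<open>r\<^sup>2\<close> over the unit interval. The value of the extension at the origin is
  \<open>k 0\<close>, on a null set.\<close>

lemma
  fixes k :: "real^3 \<Rightarrow> real"
  assumes k: "continuous_on S2 k"
  shows absolutely_integrable_radial: "(\<lambda>x. k (x /\<^sub>R norm x)) absolutely_integrable_on cball 0 1"
    and integral_radial: "integral (cball 0 1) (\<lambda>x. k (x /\<^sub>R norm x)) = (\<integral>x. k x \<partial>area_S2) / 3"
proof -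
  let ?g = "\<lambda>x :: real^3. x $ 1 *\<^sub>R spherical (x $ 2) (x $ 3)"
  let ?B = "box (vector [0, 0, 0]) (vector [1, pi, 2 * pi]) :: (real^3) set"
  let ?K = "\<lambda>x. k (x /\<^sub>R norm x)"
  define g' where "g' x h = h $ 1 *\<^sub>R spherical (x $ 2) (x $ 3)
     + x $ 1 *\<^sub>R (h $ 2 *\<^sub>R e\<^sub>\<theta> (x $ 2) (x $ 3) + (sin (x $ 2) * h $ 3) *\<^sub>R e\<^sub>\<psi> (x $ 3))" for x h :: "real^3"
  define H where "H x = (x $ 1)\<^sup>2 * (sin (x $ 2) * k (spherical (x $ 2) (x $ 3)))" for x :: "real^3"
  have nth: "((\<lambda>x. x $ i) has_derivative (\<lambda>h. h $ i)) (at x within S)" for i and x :: "real^3" and S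
    by (rule bounded_linear.has_derivative[OF bounded_linear_vec_nth has_derivative_ident])
  have der: "(?g has_derivative g' x) (at x within S)" for x S
    unfolding g'_def
    by (rule derivative_eq_intros has_derivative_spherical nth refl)+ (simp add: algebra_simps)
  have det: "det (matrix (g' x)) = (x $ 1)\<^sup>2 * sin (x $ 2)" for x
  proof -
    \<comment> \<open>The left side is the expanded Jacobian determinant: \<open>r\<close> is the
      radius, \<open>s\<close> and \<open>c\<close> are sine and cosine of the polar angle,
      \<open>q\<close> and \<open>p\<close> those of the longitude.\<close>
    have id: "r * (c * p) * (r * (s * p)) * c + r * (s * q) * (s * q) * (r * s)
        + s * p * (r * (s * p)) * (r * s) + r * (s * q) * (r * (c * q)) * c = r * r * s"
      if "s * s + c * c = 1" "q * q + p * p = 1" for r s c p q :: real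
      using that by algebra
    show ?thesis
      unfolding det_3 matrix_def g'_def e\<^sub>\<theta>_def e\<^sub>\<psi>_def
      using id[of "sin (x $ 2)" "cos (x $ 2)" "sin (x $ 3)" "cos (x $ 3)" "x $ 1"]
      by (simp add: axis_def power2_eq_square flip: power2_eq_square)
  qed
  have cH: "continuous_on S H" for S
    unfolding H_def by (intro continuous_intros continuous_on_S2_spherical[OF k])
  have eqH: "H x = \<bar>det (matrix (g' x))\<bar> * ?K (?g x)" if "x \<in> ?B" for x
  proof -
    have "0 < x $ 1" "0 < x $ 2" "x $ 2 < pi" using that by (auto simp: mem_box_cart forall_3)
    then show ?thesis using sin_gt_zero[of "x $ 2"] by (simp add: det H_def abs_mult)
  qed
  have "H absolutely_integrable_on ?B"
    by (rule set_integrable_subset[OF absolutely_integrable_continuous[OF cH] _ box_subset_cbox]) simp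
  then have int: "(\<lambda>x. \<bar>det (matrix (g' x))\<bar> * ?K (?g x)) absolutely_integrable_on ?B"
    using eqH by (rule set_integrable_cong[THEN iffD1, OF refl refl, rotated]) auto
  have "?B \<in> sets lebesgue" by simp
  note cov = integral_change_of_variables_to_real[OF this der inj_on_polar int]
  have sub: "?g ` ?B \<subseteq> cball 0 1" by (auto simp: mem_box_cart forall_3)
  have negl1: "negligible {x \<in> ?g ` ?B - cball 0 1. ?K x \<noteq> 0}"
    using sub by (intro negligible_subset[OF negligible_empty]) auto
  have negl2: "negligible {x \<in> cball 0 1 - ?g ` ?B. ?K x \<noteq> 0}"
    by (rule negligible_subset[OF negligible_cball_minus_polar_box]) auto
  show "?K absolutely_integrable_on cball 0 1"
    using absolutely_integrable_spike_set_eq[OF negl1 negl2] cov(1) by blast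
  have "integral (cball 0 1) ?K = integral (?g ` ?B) ?K"
    using integral_spike_set[OF negl1 negl2] by simp
  also have "\<dots> = integral ?B (\<lambda>x. \<bar>det (matrix (g' x))\<bar> * ?K (?g x))" by (rule cov)
  also have "\<dots> = integral ?B H" using eqH by (intro integral_cong) auto
  also have "\<dots> = integral (cbox (vector [0, 0, 0]) (vector [1, pi, 2 * pi])) H" by (rule integral_open_interval)
  also have "\<dots> = integral (cbox (0, 0, 0) (1, pi, 2 * pi)) (\<lambda>(r, \<theta>, \<psi>). H (vector [r, \<theta>, \<psi>]))"
    by (rule integral_cbox3[OF cH])
  also have "\<dots> = integral (cbox (0, (0, 0)) (1, (pi, 2 * pi))) (\<lambda>z. (fst z)\<^sup>2 *
       (sin (fst (snd z)) * k (spherical (fst (snd z)) (snd (snd z)))))"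
    by (simp add: H_def case_prod_unfold)
  also have "\<dots> = integral (cbox 0 1) (\<lambda>r. integral (cbox (0, 0) (pi, 2 * pi)) (\<lambda>w. r\<^sup>2 *
       (sin (fst w) * k (spherical (fst w) (snd w)))))"
    by (subst integral_prod_continuous)
       (auto simp only: fst_conv snd_conv intro!: continuous_intros continuous_on_S2_spherical[OF k])
  also have "\<dots> = integral (cbox 0 1) (\<lambda>r. r\<^sup>2) * integral (cbox (0, 0) (pi, 2 * pi)) (\<lambda>w. 
       (sin (fst w) * k (spherical (fst w) (snd w))))"
    by (simp only: integral_mult_right integral_mult_left)
  also have "integral (cbox (0, 0) (pi, 2 * pi)) (\<lambda>w. (sin (fst w) * k (spherical (fst w) (snd w))))
      = (\<integral>x. k x \<partial>area_S2)"
    unfolding integral_area_S2[OF k]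
    by (subst integral_prod_continuous)
       (auto simp only: fst_conv snd_conv box_real intro!: continuous_intros continuous_on_S2_spherical[OF k])
  also have "integral (cbox 0 1) (\<lambda>r :: real. r\<^sup>2) = 1 / 3"
  proof -
    have "((\<lambda>r :: real. r\<^sup>2) has_integral (1 ^ 3 / 3 - 0 ^ 3 / 3)) {0..1}"
      by (rule fundamental_theorem_of_calculus)
        (auto intro!: derivative_eq_intros simp flip: has_real_derivative_iff_has_vector_derivative)
    then show ?thesis by (simp add: integral_unique)
  qed
  finally show "integral (cball 0 1) ?K = (\<integral>x. k x \<partial>area_S2) / 3" by simp
qed


section \<open>Cyclic permutation of the coordinates\<close>

text \<open>Index arithmetic in the type \<open>3\<close> is modulo three, with
  \<open>0 = 3\<close>. The map is the rotation by 120 degrees about (1,1,1), which carries each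
  coordinate axis to the next one.\<close>

definition cyc :: "real^3 \<Rightarrow> real^3" where
  "cyc y = (\<chi> i. y $ (i - 1))"

lemma cyc_nth [simp]: "cyc y $ 1 = y $ 3" "cyc y $ 2 = y $ 1" "cyc y $ 3 = y $ 2"
proof -
  have "(0 :: 3) = 3" by simp
  then show "cyc y $ 1 = y $ 3" by (simp only: cyc_def vec_lambda_beta diff_self)
qed (simp_all add: cyc_def)

lemma linear_cyc: "linear cyc"
  by (auto intro!: linearI simp: vec_eq_iff forall_3)

lemma cyc_scaleR: "cyc (c *\<^sub>R y) = c *\<^sub>R cyc y"
  by (simp add: vec_eq_iff forall_3)

lemma inner_cyc [simp]: "cyc x \<bullet> cyc y = x \<bullet> y"
  by (simp add: inner_vec_def sum_3)

lemma norm_cyc [simp]: "norm (cyc y) = norm y"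
  by (simp add: norm_eq_sqrt_inner)

lemma cross3_cyc: "cross3 (cyc x) (cyc y) = cyc (cross3 x y)"
  by (simp add: cross3_def vec_eq_iff forall_3)

lemma cyc_cyc_cyc [simp]: "cyc (cyc (cyc y)) = y"
  by (simp add: vec_eq_iff forall_3)

lemma inj_cyc: "inj cyc"
  by (metis cyc_cyc_cyc injI)

lemma cyc_image_cball: "cyc ` cball 0 1 = cball 0 1"
proof
  show "cball 0 1 \<subseteq> cyc ` cball 0 1"
  proof
    fix x :: "real^3"
    assume "x \<in> cball 0 1"
    then show "x \<in> cyc ` cball 0 1" by (intro image_eqI[of _ _ "cyc (cyc x)"]) simp_all
  qed
qed auto

lemma continuous_on_cyc [continuous_intros]:
  "continuous_on S a \<Longrightarrow> continuous_on S (\<lambda>x. cyc (a x))"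
  using continuous_on_compose2[OF linear_continuous_on[OF linear_linear[THEN iffD2, OF linear_cyc]] _ subset_UNIV]
  by blast

text \<open>Integration over the ball makes the rotation invariance of the area measure a case of the
  linear change of variables in \<open>\<real>\<^sup>3\<close>.\<close>
lemma integral_area_S2_cyc:
  fixes k :: "real^3 \<Rightarrow> real"
  assumes k: "continuous_on S2 k"
  shows "(\<integral>x. k (cyc x) \<partial>area_S2) = (\<integral>x. k x \<partial>area_S2)"
proof -
  have kc: "continuous_on S2 (\<lambda>x. k (cyc x))"
    by (rule continuous_on_compose2[OF k]) (auto intro!: continuous_intros)
  have det: "\<bar>det (matrix cyc)\<bar> = 1"
    by (simp add: det_3 matrix_def axis_def)
  have eq: "(\<lambda>x. k (cyc (x /\<^sub>R norm x))) = (\<lambda>x. \<bar>det (matrix cyc)\<bar> * k (cyc x /\<^sub>R norm (cyc x)))"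
    unfolding det by (simp add: cyc_scaleR)
  have "integral (cball 0 1) (\<lambda>x. k (x /\<^sub>R norm x)) = integral (cyc ` cball 0 1) (\<lambda>x. k (x /\<^sub>R norm x))"
    by (simp only: cyc_image_cball)
  also have "\<dots> = integral (cball 0 1) (\<lambda>x. \<bar>det (matrix cyc)\<bar> * k (cyc x /\<^sub>R norm (cyc x)))"
  proof (rule integral_change_of_variables_to_real)
    show "(cyc has_derivative cyc) (at x within S)" for x S
      using linear_cyc by (simp add: linear_imp_has_derivative)
    show "(\<lambda>x. \<bar>det (matrix cyc)\<bar> * k (cyc x /\<^sub>R norm (cyc x))) absolutely_integrable_on cball 0 1"
      using absolutely_integrable_radial[OF kc] unfolding eq .
  qed (auto intro: inj_on_subset[OF inj_cyc])
  also have "\<dots> = integral (cball 0 1) (\<lambda>x. k (cyc (x /\<^sub>R norm x)))" unfolding eq ..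
  finally show ?thesis using integral_radial[OF k] integral_radial[OF kc] by simp
qed

section \<open>Functions on the coordinate rectangle\<close>

text \<open>Joint continuity on the whole plane and not only on the coordinate rectangle: functions
  pulled back from the sphere by \<open>spherical\<close> are defined for all angles.\<close>

abbreviation cont2 :: "(real \<Rightarrow> real \<Rightarrow> real) \<Rightarrow> bool" where
  "cont2 F \<equiv> continuous_on UNIV (\<lambda>z. F (fst z) (snd z))"

definition chart_integral :: "(real \<Rightarrow> real \<Rightarrow> real) \<Rightarrow> real" where
  "chart_integral F = integral {0..pi} (\<lambda>\<theta>. integral {0..2 * pi} (F \<theta>))"

lemma cont2_compose:
  "cont2 F \<Longrightarrow> continuous_on S a \<Longrightarrow> continuous_on S b \<Longrightarrow> continuous_on S (\<lambda>x. F (a x) (b x))"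
  using continuous_on_compose2[of UNIV "\<lambda>z. F (fst z) (snd z)" S "\<lambda>x. (a x, b x)"]
  by (auto intro: continuous_on_Pair)

lemma cont2_inner_integral:
  assumes "cont2 F"
  shows "continuous_on S (\<lambda>\<theta>. integral {0..p} (F \<theta>))"
proof -
  have "continuous_on (S \<times> cbox 0 p) (\<lambda>(\<theta>, \<psi>). F \<theta> \<psi>)"
    unfolding case_prod_unfold by (rule continuous_on_subset[OF assms]) simp
  from integral_continuous_on_param[OF this] show ?thesis by simp
qed

lemma chart_integral_cbox:
  assumes "cont2 F"
  shows "chart_integral F = integral (cbox (0, 0) (pi, 2 * pi)) (\<lambda>z. F (fst z) (snd z))"
  using integral_prod_continuous[OF continuous_on_subset[OF assms subset_UNIV], of 0 0 pi "2 * pi"]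
  unfolding chart_integral_def by (simp only: fst_conv snd_conv box_real)

lemma chart_integral_add:
  assumes "cont2 F" "cont2 G"
  shows "chart_integral (\<lambda>\<theta> \<psi>. F \<theta> \<psi> + G \<theta> \<psi>) = chart_integral F + chart_integral G"
proof -
  have "cont2 (\<lambda>\<theta> \<psi>. F \<theta> \<psi> + G \<theta> \<psi>)" using assms by (intro continuous_intros)
  then show ?thesis
    using assms
    by (simp only: chart_integral_cbox)
       (intro Henstock_Kurzweil_Integration.integral_add integrable_continuous; erule continuous_on_subset[OF _ subset_UNIV])
qed

lemma chart_integral_cmult: "chart_integral (\<lambda>\<theta> \<psi>. c * F \<theta> \<psi>) = c * chart_integral F"
  unfolding chart_integral_def by (simp only: integral_mult_right)

lemma chart_integral_sin_nonneg:
  assumes F: "cont2 F" and nn: "\<And>\<theta> \<psi>. 0 \<le> F \<theta> \<psi>"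
  shows "0 \<le> chart_integral (\<lambda>\<theta> \<psi>. sin \<theta> * F \<theta> \<psi>)"
  unfolding chart_integral_def
  by (intro Henstock_Kurzweil_Integration.integral_nonneg integrable_continuous_interval
      cont2_inner_integral[where F = "\<lambda>\<theta> \<psi>. sin \<theta> * F \<theta> \<psi>"] mult_nonneg_nonneg nn sin_ge_zero continuous_intros
      continuous_on_subset[OF F] cont2_compose[OF F]) auto

lemma continuous_zero_closed_interval:
  fixes g :: "real \<Rightarrow> real"
  assumes "continuous_on {a..b} g" "\<And>t. t \<in> {a<..<b} \<Longrightarrow> g t = 0" "a < b" "t \<in> {a..b}"
  shows "g t = 0"
  using continuous_constant_on_closure[of "{a<..<b}" g 0 t] assms by simp

text \<open>A continuous nonnegative function with integral zero vanishes; this is applied first in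
  \<theta>, then in \<psi>. The weight sin \<theta> can be cancelled away from the poles only, and
  continuity of \<open>F\<close> covers the poles.\<close>

lemma chart_integral_sin_eq_0:
  assumes F: "cont2 F" and nn: "\<And>\<theta> \<psi>. 0 \<le> F \<theta> \<psi>"
    and 0: "chart_integral (\<lambda>\<theta> \<psi>. sin \<theta> * F \<theta> \<psi>) = 0"
    and t: "\<theta> \<in> {0..pi}" "\<psi> \<in> {0..2 * pi}"
  shows "F \<theta> \<psi> = 0"
proof -
  have cs: "cont2 (\<lambda>\<theta> \<psi>. sin \<theta> * F \<theta> \<psi>)" using F by (intro continuous_intros)
  have cF: "continuous_on S (\<lambda>\<psi>. sin \<theta> * F \<theta> \<psi>)" for S \<theta>
    by (intro continuous_intros cont2_compose[OF F])
  have *: "F \<theta> \<psi> = 0" if "\<theta> \<in> {0<..<pi}" for \<theta>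
  proof -
    have "integral {0..2 * pi} (\<lambda>\<psi>. sin \<theta> * F \<theta> \<psi>) = 0"
    proof (rule continuous_integral_eq_0[of 0 pi "\<lambda>\<theta>. integral {0..2 * pi} (\<lambda>\<psi>. sin \<theta> * F \<theta> \<psi>)"])
      show "continuous_on {0..pi} (\<lambda>\<theta>. integral {0..2 * pi} (\<lambda>\<psi>. sin \<theta> * F \<theta> \<psi>))"
        by (rule cont2_inner_integral[OF cs])
      show "0 \<le> integral {0..2 * pi} (\<lambda>\<psi>. sin t * F t \<psi>)" if "t \<in> {0..pi}" for t
        using that nn
        by (intro Henstock_Kurzweil_Integration.integral_nonneg integrable_continuous_interval cF
            mult_nonneg_nonneg sin_ge_zero) auto
      show "integral {0..pi} (\<lambda>\<theta>. integral {0..2 * pi} (\<lambda>\<psi>. sin \<theta> * F \<theta> \<psi>)) = 0"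
        using 0 by (simp only: chart_integral_def)
    qed (use that in auto)
    then have "sin \<theta> * F \<theta> \<psi> = 0"
      using that t nn
      by (intro continuous_integral_eq_0[of 0 "2 * pi" "\<lambda>\<psi>. sin \<theta> * F \<theta> \<psi>" \<psi>] cF
          mult_nonneg_nonneg sin_ge_zero) auto
    then show ?thesis using that sin_gt_zero[of \<theta>] by auto
  qed
  show ?thesis
    by (rule continuous_zero_closed_interval[of 0 pi "\<lambda>\<theta>. F \<theta> \<psi>"])
       (use * t in \<open>auto intro!: cont2_compose[OF F] continuous_intros\<close>)
qed

lemma integral_area_S2_chart:
  assumes "continuous_on S2 (k :: real^3 \<Rightarrow> real)"
  shows "(\<integral>x. k x \<partial>area_S2) = chart_integral (\<lambda>\<theta> \<psi>. sin \<theta> * k (spherical \<theta> \<psi>))"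
  unfolding chart_integral_def by (rule integral_area_S2[OF assms])

text \<open>Differentiating in the two occurrences of \<open>\<theta>\<close> separately, after an integration by parts in
  \<open>\<psi>\<close> for the second one, avoids second derivatives of \<open>u\<close> and \<open>w\<close>.\<close>
lemma has_real_derivative_circle_pairing:
  assumes u: "cont2 u" and w: "cont2 w"
    and u\<theta>: "\<And>\<theta> \<psi>. ((\<lambda>s. u s \<psi>) has_real_derivative u\<theta> \<theta> \<psi>) (at \<theta>)" "cont2 u\<theta>"
    and u\<psi>: "\<And>\<theta> \<psi>. ((\<lambda>t. u \<theta> t) has_real_derivative u\<psi> \<theta> \<psi>) (at \<psi>)" "cont2 u\<psi>"
    and w\<theta>: "\<And>\<theta> \<psi>. ((\<lambda>s. w s \<psi>) has_real_derivative w\<theta> \<theta> \<psi>) (at \<theta>)" "cont2 w\<theta>"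
    and w\<psi>: "\<And>\<theta> \<psi>. ((\<lambda>t. w \<theta> t) has_real_derivative w\<psi> \<theta> \<psi>) (at \<psi>)" "cont2 w\<psi>"
    and per: "\<And>\<theta>. u \<theta> p = u \<theta> 0" "\<And>\<theta>. w \<theta> p = w \<theta> 0" and p: "0 \<le> p"
  shows "((\<lambda>\<theta>. integral {0..p} (\<lambda>\<psi>. u \<theta> \<psi> * w\<psi> \<theta> \<psi>)) has_real_derivative
     integral {0..p} (\<lambda>\<psi>. u\<theta> \<theta> \<psi> * w\<psi> \<theta> \<psi> - u\<psi> \<theta> \<psi> * w\<theta> \<theta> \<psi>)) (at \<theta>)"
proof -
  note cc = cont2_compose[OF u] cont2_compose[OF w] cont2_compose[OF u\<theta>(2)] cont2_compose[OF w\<theta>(2)]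
    cont2_compose[OF u\<psi>(2)] cont2_compose[OF w\<psi>(2)]
  define \<Phi> where "\<Phi> s t = integral {0..p} (\<lambda>\<psi>. u s \<psi> * w\<psi> t \<psi>)" for s t
  define \<Psi> where "\<Psi> s t = - integral {0..p} (\<lambda>\<psi>. u\<psi> s \<psi> * w\<theta> t \<psi>)" for s t
  have fx: "((\<lambda>s. \<Phi> s t) has_real_derivative integral {0..p} (\<lambda>\<psi>. u\<theta> s \<psi> * w\<psi> t \<psi>)) (at s)" for s t
    unfolding \<Phi>_def box_real(2)[symmetric]
    by (rule leibniz_rule_field_derivative)
       (auto intro!: derivative_eq_intros u\<theta>(1) integrable_continuous_interval continuous_intros cc simp: case_prod_unfold)
  \<comment> \<open>This form contains \<open>w\<close> itself in place of its \<psi>-derivative, so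
    differentiating in \<open>t\<close> needs \<open>w\<theta>\<close> only.\<close>
  have \<Phi>_alt: "\<Phi> s t = - integral {0..p} (\<lambda>\<psi>. u\<psi> s \<psi> * w t \<psi>)" for s t
    unfolding \<Phi>_def
    by (rule integral_by_parts_periodic[OF u\<psi>(1) _ w\<psi>(1)]) (use per p in \<open>auto intro!: cc continuous_intros\<close>)
  have fy: "((\<lambda>t. \<Phi> s t) has_real_derivative \<Psi> s t) (at t)" for s t
    unfolding \<Phi>_alt \<Psi>_def box_real(2)[symmetric]
    by (intro DERIV_minus leibniz_rule_field_derivative)
       (auto intro!: derivative_eq_intros w\<theta>(1) integrable_continuous_interval continuous_intros cc simp: case_prod_unfold)
  have c\<Psi>: "continuous_on UNIV (\<lambda>z. \<Psi> (fst z) (snd z))"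
  proof -
    have "continuous_on (UNIV \<times> cbox 0 p) (\<lambda>(z, \<psi>). u\<psi> (fst z) \<psi> * w\<theta> (snd z) \<psi>)"
      unfolding case_prod_unfold by (intro continuous_intros cc)
    from integral_continuous_on_param[OF this] show ?thesis
      unfolding \<Psi>_def by (intro continuous_intros) simp
  qed
  \<comment> \<open>Two partial derivatives, one of them continuous, give joint differentiability;
    the derivative along the diagonal is then their sum.\<close>
  have "((\<lambda>(s, t). \<Phi> s t) has_derivative
      (\<lambda>(ds, dt). integral {0..p} (\<lambda>\<psi>. u\<theta> \<theta> \<psi> * w\<psi> \<theta> \<psi>) * ds + blinfun_mult_right (\<Psi> \<theta> \<theta>) dt)) (at (\<theta>, \<theta>) within UNIV \<times> UNIV)"
  proof (rule has_derivative_partialsI[where fy = "\<lambda>s t. blinfun_mult_right (\<Psi> s t)"])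
    show "((\<lambda>s. \<Phi> s \<theta>) has_derivative (*) (integral {0..p} (\<lambda>\<psi>. u\<theta> \<theta> \<psi> * w\<psi> \<theta> \<psi>))) (at \<theta> within UNIV)"
      using fx by (simp add: has_field_derivative_def)
    show "((\<lambda>t. \<Phi> s t) has_derivative blinfun_apply (blinfun_mult_right (\<Psi> s t))) (at t within UNIV)" for s t
      using fy by (simp add: has_field_derivative_def)
    show "continuous (at (\<theta>, \<theta>) within UNIV \<times> UNIV) (\<lambda>(x, y). blinfun_mult_right (\<Psi> x y))"
      using c\<Psi> unfolding case_prod_unfold
      by (intro bounded_linear.continuous[OF bounded_linear_blinfun_mult_right])
         (simp add: continuous_on_eq_continuous_within)
  qed auto
  then have "((\<lambda>(s, t). \<Phi> s t) has_derivative
      (\<lambda>(ds, dt). integral {0..p} (\<lambda>\<psi>. u\<theta> \<theta> \<psi> * w\<psi> \<theta> \<psi>) * ds + \<Psi> \<theta> \<theta> * dt)) (at (\<theta>, \<theta>))" by simp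
  from has_derivative_compose[OF has_derivative_Pair[OF has_derivative_ident has_derivative_ident] this]
  have "((\<lambda>s. \<Phi> s s) has_derivative (\<lambda>h. integral {0..p} (\<lambda>\<psi>. u\<theta> \<theta> \<psi> * w\<psi> \<theta> \<psi>) * h + \<Psi> \<theta> \<theta> * h)) (at \<theta>)"
    by simp
  moreover have "integral {0..p} (\<lambda>\<psi>. u\<theta> \<theta> \<psi> * w\<psi> \<theta> \<psi>) + \<Psi> \<theta> \<theta>
      = integral {0..p} (\<lambda>\<psi>. u\<theta> \<theta> \<psi> * w\<psi> \<theta> \<psi> - u\<psi> \<theta> \<psi> * w\<theta> \<theta> \<psi>)"
    unfolding \<Psi>_def
    by (subst Henstock_Kurzweil_Integration.integral_diff)
       (auto intro!: integrable_continuous_interval continuous_intros cc)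
  ultimately show ?thesis
    unfolding has_field_derivative_def \<Phi>_def by (simp add: distrib_right[symmetric])
qed

section \<open>Functions of class C1 on the sphere\<close>

lemma e_nth [simp]:
  "e\<^sub>\<theta> \<theta> \<psi> $ 1 = cos \<theta> * cos \<psi>" "e\<^sub>\<theta> \<theta> \<psi> $ 2 = cos \<theta> * sin \<psi>" "e\<^sub>\<theta> \<theta> \<psi> $ 3 = - sin \<theta>"
  "e\<^sub>\<psi> \<psi> $ 1 = - sin \<psi>" "e\<^sub>\<psi> \<psi> $ 2 = cos \<psi>" "e\<^sub>\<psi> \<psi> $ 3 = 0"
  by (simp_all add: e\<^sub>\<theta>_def e\<^sub>\<psi>_def)

text \<open>Parseval's identity for the orthonormal frame.\<close>

lemma inner_frame:
  "v \<bullet> w = (v \<bullet> spherical \<theta> \<psi>) * (w \<bullet> spherical \<theta> \<psi>) + (v \<bullet> e\<^sub>\<theta> \<theta> \<psi>) * (w \<bullet> e\<^sub>\<theta> \<theta> \<psi>)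
     + (v \<bullet> e\<^sub>\<psi> \<psi>) * (w \<bullet> e\<^sub>\<psi> \<psi>)"
proof -
  have "a * x + b * y + d * z =
     (a * (s * p) + b * (s * q) + d * c) * (x * (s * p) + y * (s * q) + z * c)
     + (a * (c * p) + b * (c * q) + d * (- s)) * (x * (c * p) + y * (c * q) + z * (- s))
     + (a * (- q) + b * p) * (x * (- q) + y * p)"
    if "s * s + c * c = 1" "q * q + p * p = 1" for a b d x y z s c p q :: real
    using that by algebra
  from this[of "sin \<theta>" "cos \<theta>" "sin \<psi>" "cos \<psi>"] show ?thesis
    by (simp add: inner_vec_def sum_3 flip: power2_eq_square)
qed

lemma cross3_frame:
  "cross3 (spherical \<theta> \<psi>) (e\<^sub>\<theta> \<theta> \<psi>) = e\<^sub>\<psi> \<psi>" "cross3 (spherical \<theta> \<psi>) (e\<^sub>\<psi> \<psi>) = - e\<^sub>\<theta> \<theta> \<psi>"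
proof -
  have *: "x * (s * s) + x * (c * c) = x" if "s * s + c * c = 1" for x s c :: real
    using that by algebra
  note sc = sin_cos_squared_add[unfolded power2_eq_square]
  show "cross3 (spherical \<theta> \<psi>) (e\<^sub>\<theta> \<theta> \<psi>) = e\<^sub>\<psi> \<psi>" "cross3 (spherical \<theta> \<psi>) (e\<^sub>\<psi> \<psi>) = - e\<^sub>\<theta> \<theta> \<psi>"
    using *[OF sc, of "cos \<psi>" \<theta>] *[OF sc, of "sin \<psi>" \<theta>] *[OF sc, of "sin \<theta>" \<psi>]
    by (simp_all add: cross3_def vec_eq_iff forall_3 algebra_simps)
qed

lemma continuous_on_e\<^sub>\<theta> [continuous_intros]:
  fixes a b :: "'a::t2_space \<Rightarrow> real"
  assumes "continuous_on S a" "continuous_on S b"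
  shows "continuous_on S (\<lambda>x. e\<^sub>\<theta> (a x) (b x))"
proof -
  have "e\<^sub>\<theta> s t = spherical (s + pi / 2) t" for s t
    by (simp add: vec_eq_iff forall_3 sin_add cos_add)
  then show ?thesis using assms by (auto intro!: continuous_intros)
qed

lemma continuous_on_e\<^sub>\<psi> [continuous_intros]:
  fixes b :: "'a::t2_space \<Rightarrow> real"
  assumes "continuous_on S b"
  shows "continuous_on S (\<lambda>x. e\<^sub>\<psi> (b x))"
proof -
  have "e\<^sub>\<psi> t = spherical (pi / 2) (t + pi / 2)" for t
    by (simp add: vec_eq_iff forall_3 sin_add cos_add)
  then show ?thesis using assms by (auto intro!: continuous_intros)
qed

text \<open>The gradient is a parameter \<open>G\<close> instead of \<open>grad_S2 f\<close>, so
  that scaled and permuted functions come with explicit gradients. Normal components of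
  \<open>w\<close> are harmless in \<open>deriv\<close>, because \<open>G x\<close> is
  tangent.\<close>

locale C1_S2 =
  fixes f :: "real^3 \<Rightarrow> real" and G :: "real^3 \<Rightarrow> real^3"
  assumes cont_grad: "continuous_on S2 G"
    and tangent: "\<And>x. x \<in> S2 \<Longrightarrow> x \<bullet> G x = 0"
    and deriv: "\<And>x. x \<in> S2 \<Longrightarrow> (f has_derivative (\<lambda>w. G x \<bullet> w)) (at x within S2)"
begin

text \<open>The function in coordinates, followed by the components of its gradient in the
  orthonormal frame. The \<psi>-derivative of \<open>u\<close> is sin \<theta> times
  \<open>b\<close>; working with \<open>b\<close> avoids a division that is singular at the
  poles.\<close>

definition u :: "real \<Rightarrow> real \<Rightarrow> real" where "u \<theta> \<psi> = f (spherical \<theta> \<psi>)"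
definition a :: "real \<Rightarrow> real \<Rightarrow> real" where "a \<theta> \<psi> = G (spherical \<theta> \<psi>) \<bullet> e\<^sub>\<theta> \<theta> \<psi>"
definition b :: "real \<Rightarrow> real \<Rightarrow> real" where "b \<theta> \<psi> = G (spherical \<theta> \<psi>) \<bullet> e\<^sub>\<psi> \<psi>"

lemma cont: "continuous_on S2 f"
  using deriv has_derivative_continuous by (force simp: continuous_on_eq_continuous_within)

lemma cont2_u: "cont2 u" and cont2_a: "cont2 a" and cont2_b: "cont2 b"
  unfolding u_def a_def b_def
  by (intro continuous_intros continuous_on_S2_spherical[OF cont] continuous_on_S2_spherical[OF cont_grad])+

lemma deriv_chart:
  assumes "(p has_derivative p') (at x)" "(q has_derivative q') (at x)"
  shows "((\<lambda>x. f (spherical (p x) (q x))) has_derivative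
     (\<lambda>t. p' t * a (p x) (q x) + sin (p x) * q' t * b (p x) (q x))) (at x)"
proof -
  let ?X = "spherical (p x) (q x)"
  have "((\<lambda>x. f (spherical (p x) (q x))) has_derivative
     (\<lambda>t. G ?X \<bullet> (p' t *\<^sub>R e\<^sub>\<theta> (p x) (q x) + (sin (p x) * q' t) *\<^sub>R e\<^sub>\<psi> (q x)))) (at x)"
    by (rule has_derivative_in_compose[OF has_derivative_spherical[OF assms], of f])
       (rule has_derivative_subset[OF deriv], auto)
  then show ?thesis by (simp add: inner_add_right a_def b_def)
qed

lemma du_\<theta>: "((\<lambda>s. u s \<psi>) has_real_derivative a \<theta> \<psi>) (at \<theta>)"
  using deriv_chart[of "\<lambda>s. s" "\<lambda>t. t" \<theta> "\<lambda>_. \<psi>" "\<lambda>_. 0"]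
  by (simp add: has_field_derivative_def u_def has_derivative_ident mult_commute_abs)

lemma du_\<psi>: "((\<lambda>t. u \<theta> t) has_real_derivative sin \<theta> * b \<theta> \<psi>) (at \<psi>)"
  using deriv_chart[of "\<lambda>_. \<theta>" "\<lambda>_. 0" \<psi> "\<lambda>s. s" "\<lambda>t. t"]
  by (simp add: has_field_derivative_def u_def mult.assoc mult.left_commute has_derivative_ident mult_commute_abs)

lemma cont2_sin_b: "cont2 (\<lambda>\<theta> \<psi>. sin \<theta> * b \<theta> \<psi>)"
  by (intro continuous_intros cont2_b)

lemma u_periodic: "u \<theta> (\<psi> + 2 * pi) = u \<theta> \<psi>"
  by (simp add: u_def spherical_def)

lemma norm_grad: "(norm (G (spherical \<theta> \<psi>)))\<^sup>2 = (a \<theta> \<psi>)\<^sup>2 + (b \<theta> \<psi>)\<^sup>2"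
  unfolding power2_norm_eq_inner a_def b_def
  by (subst inner_frame[of _ _ \<theta> \<psi>])
     (simp add: tangent inner_commute[of "G _" "spherical _ _"] power2_eq_square)

lemma dirichlet_nonneg: "0 \<le> (\<integral>x. (norm (G x))\<^sup>2 \<partial>area_S2)"
  by simp

lemma dirichlet_chart:
  "(\<integral>x. (norm (G x))\<^sup>2 \<partial>area_S2) = chart_integral (\<lambda>\<theta> \<psi>. sin \<theta> * ((a \<theta> \<psi>)\<^sup>2 + (b \<theta> \<psi>)\<^sup>2))"
  by (subst integral_area_S2_chart) (auto intro!: continuous_intros cont_grad simp: norm_grad)

lemma scale: "C1_S2 (\<lambda>x. c * f x) (\<lambda>x. c *\<^sub>R G x)"
proof
  fix x assume "x \<in> S2"
  then show "((\<lambda>x. c * f x) has_derivative (\<bullet>) (c *\<^sub>R G x)) (at x within S2)"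
    using has_derivative_mult_right[OF deriv, of x c] by (simp add: inner_scaleR_left[abs_def])
qed (auto intro!: continuous_intros cont_grad simp: tangent)

lemma grad_eq_0_iff_constant: "(\<forall>x\<in>S2. G x = 0) \<longleftrightarrow> f constant_on S2"
proof
  assume 0: "\<forall>x\<in>S2. G x = 0"
  have "f x = f (spherical 0 0)" if "x \<in> S2" for x
  proof -
    obtain \<theta> \<psi> where x: "x = spherical \<theta> \<psi>" using \<open>x \<in> S2\<close> by (metis S2_eq_spherical)
    have "u \<theta> \<psi> = u 0 \<psi>"
      by (rule DERIV_isconst_all) (use du_\<theta> in \<open>simp add: a_def 0\<close>)
    also have "\<dots> = u 0 0"
      by (rule DERIV_isconst_all) (use du_\<psi> in \<open>simp add: b_def 0\<close>)
    finally show ?thesis by (simp add: u_def x)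
  qed
  then show "f constant_on S2" unfolding constant_on_def by blast
next
  assume "f constant_on S2"
  then obtain c where c: "\<And>x. x \<in> S2 \<Longrightarrow> f x = c" by (auto simp: constant_on_def)
  show "\<forall>x\<in>S2. G x = 0"
  proof
    fix x assume x: "x \<in> S2"
    have D: "(f has_derivative (\<lambda>w. 0)) (at x within S2)"
      by (rule has_derivative_transform[OF x c has_derivative_const])
    have t: "G x \<in> tangent_S2 x" using tangent[OF x] by (simp add: tangent_S2_def)
    have "G x \<bullet> G x = 0"
      using tangent_derivative_unique[OF x t deriv[OF x] D] .
    then show "G x = 0" by simp
  qed
qed

lemma dirichlet_eq_0_iff: "(\<integral>x. (norm (G x))\<^sup>2 \<partial>area_S2) = 0 \<longleftrightarrow> f constant_on S2"
  unfolding grad_eq_0_iff_constant[symmetric]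
proof
  assume 0: "(\<integral>x. (norm (G x))\<^sup>2 \<partial>area_S2) = 0"
  show "\<forall>x\<in>S2. G x = 0"
  proof
    fix x assume "x \<in> S2"
    then obtain \<theta> \<psi> where x: "\<theta> \<in> {0..pi}" "0 \<le> \<psi>" "\<psi> < 2 * pi" "x = spherical \<theta> \<psi>"
      by (metis S2_eq_spherical)
    have "(a \<theta> \<psi>)\<^sup>2 + (b \<theta> \<psi>)\<^sup>2 = 0"
    proof (rule chart_integral_sin_eq_0[of "\<lambda>\<theta> \<psi>. (a \<theta> \<psi>)\<^sup>2 + (b \<theta> \<psi>)\<^sup>2"])
      show "chart_integral (\<lambda>\<theta> \<psi>. sin \<theta> * ((a \<theta> \<psi>)\<^sup>2 + (b \<theta> \<psi>)\<^sup>2)) = 0"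
        using 0 dirichlet_chart by simp
    qed (use x in \<open>auto intro!: continuous_intros cont2_a cont2_b\<close>)
    then show "G x = 0" using norm_grad[of \<theta> \<psi>] x by simp
  qed
next
  assume "\<forall>x\<in>S2. G x = 0"
  then have "a \<theta> \<psi> = 0" "b \<theta> \<psi> = 0" for \<theta> \<psi> by (simp_all add: a_def b_def)
  then show "(\<integral>x. (norm (G x))\<^sup>2 \<partial>area_S2) = 0"
    unfolding dirichlet_chart by (simp add: chart_integral_def)
qed

end

section \<open>From smooth functions to continuous gradients\<close>

lemma Ck_on_1_gradient:
  assumes "Ck_on 1 U F"
  obtains g where "continuous_on U g" "\<And>x. x \<in> U \<Longrightarrow> (F has_derivative (\<lambda>w. g x \<bullet> w)) (at x)"
proof -
  define g :: "real^3 \<Rightarrow> real^3" where "g x = (\<chi> i. frechet_derivative F (at x) (axis i 1))" for x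
  have "continuous_on U g"
    unfolding g_def using assms by (intro continuous_on_vec_lambda) simp
  moreover have "(F has_derivative (\<lambda>w. g x \<bullet> w)) (at x)" if x: "x \<in> U" for x
  proof -
    have F: "(F has_derivative frechet_derivative F (at x)) (at x)"
      using assms x frechet_derivative_works by fastforce
    have lin: "linear (frechet_derivative F (at x))" using F has_derivative_linear by blast
    have "frechet_derivative F (at x) w = g x \<bullet> w" for w
    proof -
      have "frechet_derivative F (at x) w = frechet_derivative F (at x) (\<Sum>i\<in>UNIV. w $ i *\<^sub>R axis i 1)"
        by (simp only: basis_expansion flip: scalar_mult_eq_scaleR)
      also have "\<dots> = g x \<bullet> w"
        by (simp add: g_def linear_sum[OF lin] linear_cmul[OF lin] inner_vec_def mult.commute)
      finally show ?thesis .
    qed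
    then have "frechet_derivative F (at x) = (\<lambda>w. g x \<bullet> w)" by blast
    with F show ?thesis by simp
  qed
  ultimately show thesis by (rule that)
qed

text \<open>Near each point the gradient is the tangential projection \<open>p\<close> of the
  ambient gradient of an extension, and \<open>p\<close> is continuous.\<close>

lemma smooth_on_S2_imp_C1:
  assumes "smooth_on_S2 f"
  shows "C1_S2 f (grad_S2 f)"
proof -
  have nbhd: "\<exists>U (p :: real^3 \<Rightarrow> real^3). open U \<and> x \<in> U \<and> continuous_on U p \<and>
     (\<forall>y\<in>U \<inter> S2. grad_S2 f y = p y \<and> y \<bullet> p y = 0 \<and> (f has_derivative (\<lambda>w. p y \<bullet> w)) (at y within S2))"
    if "x \<in> S2" for x
  proof -
    obtain U F where U: "open U" "x \<in> U" and C: "\<forall>k. Ck_on k U F" and eq: "\<forall>y\<in>U \<inter> S2. F y = f y"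
      using bspec[OF assms[unfolded smooth_on_S2_def] \<open>x \<in> S2\<close>] by (elim exE conjE)
    obtain g where g: "continuous_on U g" "\<And>x. x \<in> U \<Longrightarrow> (F has_derivative (\<lambda>w. g x \<bullet> w)) (at x)"
      using Ck_on_1_gradient[OF C[rule_format]] by blast
    define p where "p y = g y - (g y \<bullet> y) *\<^sub>R y" for y
    have "grad_S2 f y = p y \<and> y \<bullet> p y = 0 \<and> (f has_derivative (\<lambda>w. p y \<bullet> w)) (at y within S2)"
      if y: "y \<in> U \<inter> S2" for y
    proof -
      have yy: "y \<bullet> y = 1" using y by (simp add: norm_eq_1)
      have tan: "y \<bullet> p y = 0" by (simp add: p_def inner_diff_right yy inner_commute)
      \<comment> \<open>The subtracted term vanishes on the sphere and its differential is the
        normal part of \<open>g y\<close>. Hence \<open>p y\<close> represents a derivative within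
        \<open>S2\<close> on all vectors, as \<open>C1_S2\<close> requires, and not only on tangent
        ones.\<close>
      have "((\<lambda>z. F z - (g y \<bullet> y) * ((z \<bullet> z - 1) / 2)) has_derivative (\<lambda>w. p y \<bullet> w)) (at y within S2)"
        by (rule derivative_eq_intros has_derivative_at_withinI[OF g(2)] refl | use y in blast)+
           (auto simp: p_def fun_eq_iff inner_diff_left inner_diff_right inner_commute field_simps)
      moreover obtain d where d: "0 < d" "ball y d \<subseteq> U"
        using U(1) y open_contains_ball by blast
      moreover have "F z - (g y \<bullet> y) * ((z \<bullet> z - 1) / 2) = f z" if "z \<in> S2" "dist z y < d" for z
      proof -
        have "z \<in> U" using d that by (auto simp: dist_commute)
        moreover have "z \<bullet> z = 1" using \<open>z \<in> S2\<close> by (simp add: norm_eq_1)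
        ultimately show ?thesis using eq \<open>z \<in> S2\<close> by simp
      qed
      ultimately have D: "(f has_derivative (\<lambda>w. p y \<bullet> w)) (at y within S2)"
        using y by (blast intro: has_derivative_transform_within)
      have "grad_S2 f y = p y"
        by (rule grad_S2_eqI[OF _ _ D]) (use y tan in \<open>auto simp: tangent_S2_def\<close>)
      with D tan show ?thesis by blast
    qed
    moreover have "continuous_on U p" unfolding p_def by (intro continuous_intros g(1))
    ultimately show ?thesis using U by (intro exI[of _ U] exI[of _ p]) simp
  qed
  show ?thesis
  proof
    fix x assume x: "x \<in> S2"
    show "x \<bullet> grad_S2 f x = 0" "(f has_derivative (\<bullet>) (grad_S2 f x)) (at x within S2)"
      using nbhd[OF x] x by (elim exE conjE, simp)+
  next
    show "continuous_on S2 (grad_S2 f)"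
      unfolding continuous_on_eq_continuous_within
    proof
      fix x assume x: "x \<in> S2"
      obtain U p where U: "open U" "x \<in> U" "continuous_on U p"
        and eq: "\<forall>y\<in>U \<inter> S2. grad_S2 f y = p y \<and> y \<bullet> p y = 0 \<and> (f has_derivative (\<lambda>w. p y \<bullet> w)) (at y within S2)"
        using nbhd[OF x] by (elim exE conjE)
      have "continuous_on (U \<inter> S2) (grad_S2 f)"
        by (rule continuous_on_eq[OF continuous_on_subset[OF U(3)]]) (use eq in auto)
      then have "continuous (at x within U \<inter> S2) (grad_S2 f)"
        using U(2) x by (simp add: continuous_on_eq_continuous_within)
      moreover have "at x within U \<inter> S2 = at x within S2"
        by (rule at_within_nhd[OF U(2,1)]) blast
      ultimately show "continuous (at x within S2) (grad_S2 f)" by simp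
    qed
  qed
qed

section \<open>Nonnegativity of the energy\<close>

text \<open>The equation says that \<open>D / sin\<close> has derivative zero; the constant is its
  value at the equator. This solves the equations along the meridians.\<close>

lemma DERIV_ratio_sin:
  fixes D D' :: "real \<Rightarrow> real"
  assumes D: "\<And>\<theta>. \<theta> \<in> {0<..<pi} \<Longrightarrow> (D has_real_derivative D' \<theta>) (at \<theta>)"
    and ode: "\<And>\<theta>. \<theta> \<in> {0<..<pi} \<Longrightarrow> sin \<theta> * D' \<theta> = cos \<theta> * D \<theta>"
    and t: "\<theta> \<in> {0<..<pi}"
  shows "D \<theta> = sin \<theta> * D (pi / 2)"
proof -
  have "D \<theta> / sin \<theta> = D (pi / 2) / sin (pi / 2)"
  proof (rule DERIV_isconst3[of 0 pi _ _ "\<lambda>s. D s / sin s"])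
    fix s assume s: "s \<in> {0<..<pi}"
    then have "sin s \<noteq> 0" using sin_gt_zero[of s] by auto
    then show "((\<lambda>s. D s / sin s) has_real_derivative 0) (at s)"
      using ode[OF s] by (auto intro!: derivative_eq_intros D[OF s] simp: mult.commute)
  qed (use t in auto)
  then show ?thesis using t sin_gt_zero[of \<theta>] by (auto simp: field_simps)
qed

text \<open>In complex form \<open>p + i q\<close> satisfies z' = i z, so its product with e^(-it)
  is constant; the facts \<open>1\<close> and \<open>2\<close> are the real and the imaginary
  part.\<close>

lemma rotation_ode:
  fixes p q :: "real \<Rightarrow> real"
  assumes p: "\<And>t. t \<in> {0..T} \<Longrightarrow> (p has_real_derivative - q t) (at t within {0..T})"
    and q: "\<And>t. t \<in> {0..T} \<Longrightarrow> (q has_real_derivative p t) (at t within {0..T})"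
    and t: "t \<in> {0..T}"
  shows "p t = p 0 * cos t - q 0 * sin t" "q t = p 0 * sin t + q 0 * cos t"
proof -
  have 1: "p t * cos t + q t * sin t = p 0 * cos 0 + q 0 * sin 0"
  proof -
    have "\<exists>c. \<forall>t\<in>{0..T}. p t * cos t + q t * sin t = c"
      by (rule has_field_derivative_zero_constant) (auto intro!: derivative_eq_intros p q)
    then show ?thesis using t by force
  qed
  have 2: "q t * cos t - p t * sin t = q 0 * cos 0 - p 0 * sin 0"
  proof -
    have "\<exists>c. \<forall>t\<in>{0..T}. q t * cos t - p t * sin t = c"
      by (rule has_field_derivative_zero_constant) (auto intro!: derivative_eq_intros p q)
    then show ?thesis using t by force
  qed
  have sc: "sin t * sin t + cos t * cos t = 1"
    using sin_cos_squared_add[of t] by (simp add: power2_eq_square)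
  have 3: "p t * cos t + q t * sin t = p 0" "q t * cos t - p t * sin t = q 0" using 1 2 by simp_all
  have P: "P = (P * c + Q * s) * c - (Q * c - P * s) * s" if "s * s + c * c = 1" for P Q c s :: real
    using that by algebra
  have Q: "Q = (P * c + Q * s) * s + (Q * c - P * s) * c" if "s * s + c * c = 1" for P Q c s :: real
    using that by algebra
  show "p t = p 0 * cos t - q 0 * sin t" using P[OF sc, of "p t" "q t"] unfolding 3 .
  show "q t = p 0 * sin t + q 0 * cos t" using Q[OF sc, of "q t" "p t"] unfolding 3 .
qed

locale C1_S2_pair = F: C1_S2 f Gf + H: C1_S2 h Gh for f Gf h Gh
begin

text \<open>With \<open>L\<^sub>+ = e\<^sup>i\<^sup>\<psi> (\<partial>\<^sub>\<theta> + i cot \<theta> \<partial>\<^sub>\<psi>)\<close> the raising operator, \<open>N\<close> is \<open>\<bar>L\<^sub>+ (f + i h)\<bar>\<^sup>2\<close>, and \<open>W\<close> is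
  the isoperimetric deficit of the curve \<open>(f, h)\<close> over the circle of latitude \<open>\<theta>\<close>.\<close>
definition N :: "real \<Rightarrow> real \<Rightarrow> real" where
  "N \<theta> \<psi> = (F.a \<theta> \<psi> - cos \<theta> * H.b \<theta> \<psi>)\<^sup>2 + (H.a \<theta> \<psi> + cos \<theta> * F.b \<theta> \<psi>)\<^sup>2"

definition W :: "real \<Rightarrow> real" where
  "W \<theta> = integral {0..2 * pi} (\<lambda>\<psi>. (sin \<theta> * F.b \<theta> \<psi>)\<^sup>2 + (sin \<theta> * H.b \<theta> \<psi>)\<^sup>2
     - 2 * (F.u \<theta> \<psi> * (sin \<theta> * H.b \<theta> \<psi>)))"

text \<open>Its nonnegativity is the inequality with the product of the two norms weakened to half
  the sum of their squares. The coordinate is the third one because that is the axis of the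
  chart.\<close>

definition energy :: real where
  "energy = (\<integral>x. (norm (Gf x))\<^sup>2 \<partial>area_S2) + (\<integral>x. (norm (Gh x))\<^sup>2 \<partial>area_S2)
     - 4 * (\<integral>x. x $ 3 * (J_S2 x (Gf x) \<bullet> Gh x) \<partial>area_S2)"

lemmas conts = F.cont2_u F.cont2_a F.cont2_b H.cont2_u H.cont2_a H.cont2_b
lemmas conts2 = conts[THEN cont2_compose]

text \<open>\<open>J_S2\<close> turns \<open>e\<^sub>\<theta>\<close> into
  \<open>e\<^sub>\<psi>\<close> and \<open>e\<^sub>\<psi>\<close> into minus
  \<open>e\<^sub>\<theta>\<close>.\<close>

lemma J_chart:
  "J_S2 (spherical \<theta> \<psi>) (Gf (spherical \<theta> \<psi>)) \<bullet> Gh (spherical \<theta> \<psi>) =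
     F.a \<theta> \<psi> * H.b \<theta> \<psi> - F.b \<theta> \<psi> * H.a \<theta> \<psi>"
proof -
  let ?X = "spherical \<theta> \<psi>" and ?t = "e\<^sub>\<theta> \<theta> \<psi>" and ?p = "e\<^sub>\<psi> \<psi>"
  have "cross3 ?X (Gf ?X) \<bullet> ?t = - (Gf ?X \<bullet> ?p)"
    by (metis cross3_frame(1) cross_triple cross_skew inner_commute inner_minus_right)
  moreover have "cross3 ?X (Gf ?X) \<bullet> ?p = Gf ?X \<bullet> ?t"
    by (metis cross3_frame(2) cross_triple cross_skew inner_commute inner_minus_right minus_minus)
  ultimately show ?thesis
    unfolding J_S2_def
    by (subst inner_frame[of _ _ \<theta> \<psi>]) (simp add: dot_cross_self F.a_def F.b_def H.a_def H.b_def)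
qed

text \<open>By \<open>has_real_derivative_circle_pairing\<close>, sin \<theta> times the bracket
  integrates over a circle of latitude to the derivative of \<open>A\<close>. Integrating this
  against cos \<theta> by parts leaves no boundary terms, as \<open>A\<close> contains the factor
  sin \<theta>.\<close>

lemma weighted_bracket_by_parts:
  "chart_integral (\<lambda>\<theta> \<psi>. sin \<theta> * (cos \<theta> * (F.a \<theta> \<psi> * H.b \<theta> \<psi> - F.b \<theta> \<psi> * H.a \<theta> \<psi>)))
     = chart_integral (\<lambda>\<theta> \<psi>. sin \<theta> * (F.u \<theta> \<psi> * (sin \<theta> * H.b \<theta> \<psi>)))"
proof -
  define A where "A \<theta> = integral {0..2 * pi} (\<lambda>\<psi>. F.u \<theta> \<psi> * (sin \<theta> * H.b \<theta> \<psi>))" for \<theta>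
  define A' where "A' \<theta> = integral {0..2 * pi} (\<lambda>\<psi>. F.a \<theta> \<psi> * (sin \<theta> * H.b \<theta> \<psi>) - (sin \<theta> * F.b \<theta> \<psi>) * H.a \<theta> \<psi>)" for \<theta>
  have dA: "(A has_real_derivative A' \<theta>) (at \<theta>)" for \<theta>
    unfolding A_def[abs_def] A'_def
    by (rule has_real_derivative_circle_pairing[where u = F.u and w = H.u and w\<theta> = H.a])
       (use F.u_periodic[of _ 0] H.u_periodic[of _ 0] in
         \<open>simp_all add: F.du_\<theta> F.du_\<psi> H.du_\<theta> H.du_\<psi> conts F.cont2_sin_b H.cont2_sin_b\<close>)
  have cA: "continuous_on S A" for S
    using dA by (meson DERIV_continuous_on DERIV_subset subset_UNIV)
  have cA': "continuous_on S A'" for S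
    unfolding A'_def[abs_def]
    by (rule cont2_inner_integral[where F = "\<lambda>\<theta> \<psi>. F.a \<theta> \<psi> * (sin \<theta> * H.b \<theta> \<psi>) - (sin \<theta> * F.b \<theta> \<psi>) * H.a \<theta> \<psi>"])
       (intro continuous_intros conts)
  have "((\<lambda>\<theta>. cos \<theta> * A' \<theta> - sin \<theta> * A \<theta>) has_integral (cos pi * A pi - cos 0 * A 0)) {0..pi}"
    by (rule fundamental_theorem_of_calculus)
       (auto intro!: derivative_eq_intros DERIV_subset[OF dA]
         simp flip: has_real_derivative_iff_has_vector_derivative)
  then have "integral {0..pi} (\<lambda>\<theta>. cos \<theta> * A' \<theta> - sin \<theta> * A \<theta>) = 0"
    by (simp add: A_def integral_unique)
  moreover have "integral {0..pi} (\<lambda>\<theta>. cos \<theta> * A' \<theta> - sin \<theta> * A \<theta>)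
      = integral {0..pi} (\<lambda>\<theta>. cos \<theta> * A' \<theta>) - integral {0..pi} (\<lambda>\<theta>. sin \<theta> * A \<theta>)"
    by (intro Henstock_Kurzweil_Integration.integral_diff integrable_continuous_interval continuous_intros cA cA')
  ultimately have "integral {0..pi} (\<lambda>\<theta>. cos \<theta> * A' \<theta>) = integral {0..pi} (\<lambda>\<theta>. sin \<theta> * A \<theta>)" by simp
  then show ?thesis
    unfolding chart_integral_def A_def A'_def integral_mult_right[symmetric]
    by (simp only: algebra_simps)
qed

lemma cont2_N: "cont2 N"
  unfolding N_def by (intro continuous_intros conts)

text \<open>Of the four copies of the weighted bracket, two are absorbed by completing squares
  pointwise; the other two, integrated by parts, supply the mixed term of \<open>W\<close>.\<close>

lemma energy_eq: "energy = chart_integral (\<lambda>\<theta> \<psi>. sin \<theta> * N \<theta> \<psi>) + integral {0..pi} (\<lambda>\<theta>. sin \<theta> * W \<theta>)"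
proof -
  let ?Q = "\<lambda>\<theta> \<psi>. F.a \<theta> \<psi> * H.b \<theta> \<psi> - F.b \<theta> \<psi> * H.a \<theta> \<psi>"
  let ?w = "\<lambda>\<theta> \<psi>. (sin \<theta> * F.b \<theta> \<psi>)\<^sup>2 + (sin \<theta> * H.b \<theta> \<psi>)\<^sup>2"
  have I: "(\<integral>x. x $ 3 * (J_S2 x (Gf x) \<bullet> Gh x) \<partial>area_S2) = chart_integral (\<lambda>\<theta> \<psi>. sin \<theta> * (cos \<theta> * ?Q \<theta> \<psi>))"
  proof -
    have "continuous_on S2 (\<lambda>x. x $ 3 * (J_S2 x (Gf x) \<bullet> Gh x))"
      unfolding J_S2_def by (intro continuous_intros continuous_on_cross F.cont_grad H.cont_grad)
    from integral_area_S2_chart[OF this] show ?thesis by (simp add: J_chart)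
  qed
  have c: "cont2 (\<lambda>\<theta> \<psi>. sin \<theta> * ((F.a \<theta> \<psi>)\<^sup>2 + (F.b \<theta> \<psi>)\<^sup>2))" "cont2 (\<lambda>\<theta> \<psi>. sin \<theta> * ((H.a \<theta> \<psi>)\<^sup>2 + (H.b \<theta> \<psi>)\<^sup>2))"
    "cont2 (\<lambda>\<theta> \<psi>. sin \<theta> * (cos \<theta> * ?Q \<theta> \<psi>))" "cont2 (\<lambda>\<theta> \<psi>. sin \<theta> * (F.u \<theta> \<psi> * (sin \<theta> * H.b \<theta> \<psi>)))"
    "cont2 (\<lambda>\<theta> \<psi>. sin \<theta> * N \<theta> \<psi>)" "cont2 (\<lambda>\<theta> \<psi>. sin \<theta> * ?w \<theta> \<psi>)"
    by (intro continuous_intros conts cont2_N)+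
  have "chart_integral (\<lambda>\<theta> \<psi>. sin \<theta> * ((F.a \<theta> \<psi>)\<^sup>2 + (F.b \<theta> \<psi>)\<^sup>2)) + chart_integral (\<lambda>\<theta> \<psi>. sin \<theta> * ((H.a \<theta> \<psi>)\<^sup>2 + (H.b \<theta> \<psi>)\<^sup>2))
     = chart_integral (\<lambda>\<theta> \<psi>. sin \<theta> * N \<theta> \<psi> + sin \<theta> * ?w \<theta> \<psi> + 2 * (sin \<theta> * (cos \<theta> * ?Q \<theta> \<psi>)))"
  proof -
    \<comment> \<open>Here \<open>a\<close>, \<open>b\<close> are the gradient components of
      \<open>f\<close>, and \<open>x\<close>, \<open>y\<close> those of \<open>h\<close>.\<close>
    have id: "s * (a * a + b * b) + s * (x * x + y * y) =
      s * ((a - c * y) * (a - c * y) + (x + c * b) * (x + c * b)) + s * ((s * b) * (s * b) + (s * y) * (s * y))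
      + 2 * (s * (c * (a * y - b * x)))" if "s * s + c * c = 1" for s c a b x y :: real
      using that by algebra
    have "sin \<theta> * ((F.a \<theta> \<psi>)\<^sup>2 + (F.b \<theta> \<psi>)\<^sup>2) + sin \<theta> * ((H.a \<theta> \<psi>)\<^sup>2 + (H.b \<theta> \<psi>)\<^sup>2)
      = sin \<theta> * N \<theta> \<psi> + sin \<theta> * ?w \<theta> \<psi> + 2 * (sin \<theta> * (cos \<theta> * ?Q \<theta> \<psi>))" for \<theta> \<psi>
      using id[OF sin_cos_squared_add[unfolded power2_eq_square, of \<theta>]]
      unfolding N_def power2_eq_square .
    then show ?thesis by (simp only: chart_integral_add[OF c(1,2), symmetric])
  qed
  also have "\<dots> = chart_integral (\<lambda>\<theta> \<psi>. sin \<theta> * N \<theta> \<psi>) + chart_integral (\<lambda>\<theta> \<psi>. sin \<theta> * ?w \<theta> \<psi>)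
      + 2 * chart_integral (\<lambda>\<theta> \<psi>. sin \<theta> * (cos \<theta> * ?Q \<theta> \<psi>))"
    by (simp only: chart_integral_add c continuous_on_add continuous_on_mult continuous_on_const chart_integral_cmult)
  finally have 1: "energy = chart_integral (\<lambda>\<theta> \<psi>. sin \<theta> * N \<theta> \<psi>) + chart_integral (\<lambda>\<theta> \<psi>. sin \<theta> * ?w \<theta> \<psi>)
      - 2 * chart_integral (\<lambda>\<theta> \<psi>. sin \<theta> * (F.u \<theta> \<psi> * (sin \<theta> * H.b \<theta> \<psi>)))"
    unfolding energy_def F.dirichlet_chart H.dirichlet_chart I weighted_bracket_by_parts by linarith
  have "chart_integral (\<lambda>\<theta> \<psi>. sin \<theta> * ?w \<theta> \<psi>) + (- 2) * chart_integral (\<lambda>\<theta> \<psi>. sin \<theta> * (F.u \<theta> \<psi> * (sin \<theta> * H.b \<theta> \<psi>)))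
     = chart_integral (\<lambda>\<theta> \<psi>. sin \<theta> * ?w \<theta> \<psi> + (- 2) * (sin \<theta> * (F.u \<theta> \<psi> * (sin \<theta> * H.b \<theta> \<psi>))))"
    unfolding chart_integral_cmult[symmetric]
    by (intro chart_integral_add[symmetric] c continuous_on_mult continuous_on_const)
  also have "\<dots> = chart_integral (\<lambda>\<theta> \<psi>. sin \<theta> * (?w \<theta> \<psi> - 2 * (F.u \<theta> \<psi> * (sin \<theta> * H.b \<theta> \<psi>))))"
    by (rule arg_cong[of _ _ chart_integral]) (simp add: fun_eq_iff right_diff_distrib)
  also have "\<dots> = integral {0..pi} (\<lambda>\<theta>. sin \<theta> * W \<theta>)"
    unfolding chart_integral_def W_def integral_mult_right[symmetric] ..
  finally show ?thesis using 1 by linarith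
qed

end

section \<open>The sign of the energy and its zeros\<close>

context C1_S2_pair
begin

text \<open>Up to constants, \<open>f + i h\<close> is a complex multiple, by
  \<open>A - i B\<close>, of x_1 + i x_2.\<close>

definition linear_pair :: bool where
  "linear_pair \<longleftrightarrow> (\<exists>A B c c'. \<forall>x\<in>S2. f x = A * x $ 1 + B * x $ 2 + c \<and> h x = - B * x $ 1 + A * x $ 2 + c')"

lemma hurwitz_W:
  "0 \<le> W \<theta>"
  "W \<theta> = 0 \<Longrightarrow> \<exists>c. \<forall>\<psi>\<in>{0..2 * pi}. sin \<theta> * H.b \<theta> \<psi> = F.u \<theta> \<psi> - c"
  unfolding W_def
  by (rule hurwitz[OF F.du_\<psi> cont2_compose[OF F.cont2_sin_b continuous_on_const continuous_on_id]
        H.du_\<psi> cont2_compose[OF H.cont2_sin_b continuous_on_const continuous_on_id] F.u_periodic H.u_periodic]; assumption)+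

text \<open>The equality case of \<open>hurwitz\<close> gives only one of the two first order
  equations on the circle. The deficit is unchanged when \<open>(f, h)\<close> is replaced by
  \<open>(h, -f)\<close>, by an integration by parts, and this yields the other one.\<close>

lemma hurwitz_W_swapped:
  assumes "W \<theta> = 0"
  shows "\<exists>c. \<forall>\<psi>\<in>{0..2 * pi}. - (sin \<theta> * F.b \<theta> \<psi>) = H.u \<theta> \<psi> - c"
proof (rule hurwitz(2)[OF H.du_\<psi> cont2_compose[OF H.cont2_sin_b continuous_on_const continuous_on_id]
        DERIV_minus[OF F.du_\<psi>] _ H.u_periodic])
  show "continuous_on UNIV (\<lambda>t. - (sin \<theta> * F.b \<theta> t))"
    by (intro continuous_intros conts2)
  show "- F.u \<theta> (t + 2 * pi) = - F.u \<theta> t" for t by (simp add: F.u_periodic)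
  have parts: "integral {0..2 * pi} (\<lambda>\<psi>. F.u \<theta> \<psi> * (sin \<theta> * H.b \<theta> \<psi>))
      = - integral {0..2 * pi} (\<lambda>\<psi>. (sin \<theta> * F.b \<theta> \<psi>) * H.u \<theta> \<psi>)"
    by (rule integral_by_parts_periodic[OF F.du_\<psi> _ H.du_\<psi>])
       (use F.u_periodic[of _ 0] H.u_periodic[of _ 0] in \<open>auto intro!: continuous_intros conts2\<close>)
  let ?I = "\<lambda>\<psi>. (sin \<theta> * F.b \<theta> \<psi>)\<^sup>2 + (sin \<theta> * H.b \<theta> \<psi>)\<^sup>2"
  have i: "?I integrable_on {0..2 * pi}" "(\<lambda>\<psi>. 2 * (F.u \<theta> \<psi> * (sin \<theta> * H.b \<theta> \<psi>))) integrable_on {0..2 * pi}"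
    "(\<lambda>\<psi>. 2 * ((sin \<theta> * F.b \<theta> \<psi>) * H.u \<theta> \<psi>)) integrable_on {0..2 * pi}"
    by (intro integrable_continuous_interval continuous_intros conts2)+
  have eq: "(\<lambda>t. (sin \<theta> * H.b \<theta> t)\<^sup>2 + (- (sin \<theta> * F.b \<theta> t))\<^sup>2 - 2 * (H.u \<theta> t * - (sin \<theta> * F.b \<theta> t)))
     = (\<lambda>t. ?I t + 2 * ((sin \<theta> * F.b \<theta> t) * H.u \<theta> t))"
    by (simp add: fun_eq_iff)
  show "integral {0..2 * pi} (\<lambda>t. (sin \<theta> * H.b \<theta> t)\<^sup>2 + (- (sin \<theta> * F.b \<theta> t))\<^sup>2 - 2 * (H.u \<theta> t * - (sin \<theta> * F.b \<theta> t))) = 0"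
    using assms parts
    unfolding eq W_def Henstock_Kurzweil_Integration.integral_add[OF i(1,3)]
      Henstock_Kurzweil_Integration.integral_diff[OF i(1,2)] integral_mult_right by linarith
qed

lemma continuous_on_W: "continuous_on S W"
  unfolding W_def[abs_def]
  by (rule cont2_inner_integral) (intro continuous_intros conts)

lemma energy_parts_nonneg:
  "0 \<le> chart_integral (\<lambda>\<theta> \<psi>. sin \<theta> * N \<theta> \<psi>)" "0 \<le> integral {0..pi} (\<lambda>\<theta>. sin \<theta> * W \<theta>)"
proof -
  show "0 \<le> chart_integral (\<lambda>\<theta> \<psi>. sin \<theta> * N \<theta> \<psi>)"
    by (rule chart_integral_sin_nonneg[OF cont2_N]) (simp add: N_def)
  show "0 \<le> integral {0..pi} (\<lambda>\<theta>. sin \<theta> * W \<theta>)"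
    by (intro Henstock_Kurzweil_Integration.integral_nonneg integrable_continuous_interval continuous_intros continuous_on_W
        mult_nonneg_nonneg sin_ge_zero hurwitz_W(1)) auto
qed

lemma energy_nonneg: "0 \<le> energy"
  unfolding energy_eq using energy_parts_nonneg by linarith

text \<open>The vanishing of \<open>W\<close> makes the image of each circle of latitude under
  \<open>(f, h)\<close> a round circle, traversed uniformly. The vanishing of \<open>N\<close>
  governs the passage between latitudes: the centre stays fixed and the radius is proportional to
  sin \<theta>.\<close>

lemma linear_pair_if_energy_eq_0:
  assumes 0: "energy = 0"
  shows linear_pair
proof -
  have N0: "chart_integral (\<lambda>\<theta> \<psi>. sin \<theta> * N \<theta> \<psi>) = 0" and W0: "integral {0..pi} (\<lambda>\<theta>. sin \<theta> * W \<theta>) = 0"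
    using 0 energy_parts_nonneg unfolding energy_eq by linarith+
  have W: "W \<theta> = 0" if t: "\<theta> \<in> {0<..<pi}" for \<theta>
  proof -
    have "sin \<theta> * W \<theta> = 0"
      by (rule continuous_integral_eq_0[of 0 pi "\<lambda>\<theta>. sin \<theta> * W \<theta>"])
         (use t W0 in \<open>auto intro!: continuous_intros continuous_on_W mult_nonneg_nonneg sin_ge_zero hurwitz_W(1)\<close>)
    then show ?thesis using sin_gt_zero[of \<theta>] t by auto
  qed
  have N: "F.a \<theta> \<psi> = cos \<theta> * H.b \<theta> \<psi> \<and> H.a \<theta> \<psi> = - cos \<theta> * F.b \<theta> \<psi>"
    if "\<theta> \<in> {0..pi}" "\<psi> \<in> {0..2 * pi}" for \<theta> \<psi>
  proof -
    have "N \<theta> \<psi> = 0"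
      by (rule chart_integral_sin_eq_0[OF cont2_N _ N0]) (use that in \<open>simp_all add: N_def\<close>)
    then show ?thesis by (simp add: N_def sum_power2_eq_zero_iff)
  qed
  \<comment> \<open>The midpoint of two antipodal values is the centre of the circle. This explicit
    formula can be differentiated in \<theta>, unlike the constants whose existence
    \<open>hurwitz\<close> asserts for each \<theta> separately.\<close>
  define c where "c \<theta> = (F.u \<theta> 0 + F.u \<theta> pi) / 2" for \<theta>
  define d where "d \<theta> = (H.u \<theta> 0 + H.u \<theta> pi) / 2" for \<theta>
  have circle: "sin \<theta> * H.b \<theta> \<psi> = F.u \<theta> \<psi> - c \<theta> \<and> sin \<theta> * F.b \<theta> \<psi> = - (H.u \<theta> \<psi> - d \<theta>)
      \<and> F.u \<theta> \<psi> - c \<theta> = (F.u \<theta> 0 - c \<theta>) * cos \<psi> - (H.u \<theta> 0 - d \<theta>) * sin \<psi>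
      \<and> H.u \<theta> \<psi> - d \<theta> = (F.u \<theta> 0 - c \<theta>) * sin \<psi> + (H.u \<theta> 0 - d \<theta>) * cos \<psi>"
    if t: "\<theta> \<in> {0<..<pi}" and p: "\<psi> \<in> {0..2 * pi}" for \<theta> \<psi>
  proof -
    obtain c' where c': "\<And>\<psi>. \<psi> \<in> {0..2 * pi} \<Longrightarrow> sin \<theta> * H.b \<theta> \<psi> = F.u \<theta> \<psi> - c'"
      using hurwitz_W(2)[OF W[OF t]] by blast
    obtain d' where d': "\<And>\<psi>. \<psi> \<in> {0..2 * pi} \<Longrightarrow> - (sin \<theta> * F.b \<theta> \<psi>) = H.u \<theta> \<psi> - d'"
      using hurwitz_W_swapped[OF W[OF t]] by blast
    have dp: "((\<lambda>\<psi>. F.u \<theta> \<psi> - c') has_real_derivative - (H.u \<theta> \<psi> - d')) (at \<psi> within {0..2 * pi})"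
      if "\<psi> \<in> {0..2 * pi}" for \<psi>
      using d'[OF that] by (auto intro!: derivative_eq_intros DERIV_subset[OF F.du_\<psi>])
    have dq: "((\<lambda>\<psi>. H.u \<theta> \<psi> - d') has_real_derivative (F.u \<theta> \<psi> - c')) (at \<psi> within {0..2 * pi})"
      if "\<psi> \<in> {0..2 * pi}" for \<psi>
      using c'[OF that] by (auto intro!: derivative_eq_intros DERIV_subset[OF H.du_\<psi>])
    have rot: "F.u \<theta> t - c' = (F.u \<theta> 0 - c') * cos t - (H.u \<theta> 0 - d') * sin t"
      "H.u \<theta> t - d' = (F.u \<theta> 0 - c') * sin t + (H.u \<theta> 0 - d') * cos t" if "t \<in> {0..2 * pi}" for t
      by (rule rotation_ode[where p = "\<lambda>\<psi>. F.u \<theta> \<psi> - c'" and q = "\<lambda>\<psi>. H.u \<theta> \<psi> - d'", OF dp dq that]; assumption)+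
    have "c' = c \<theta>" using rot(1)[of pi] by (simp add: c_def)
    moreover have "d' = d \<theta>" using rot(2)[of pi] by (simp add: d_def)
    ultimately show ?thesis using rot[OF p] c'[OF p] d'[OF p] by simp
  qed
  have dc: "c \<theta> = c (pi / 2)" and dd: "d \<theta> = d (pi / 2)" if t: "\<theta> \<in> {0<..<pi}" for \<theta>
  proof -
    have s: "sin \<theta> \<noteq> 0" if "\<theta> \<in> {0<..<pi}" for \<theta>
      using that sin_gt_zero[of \<theta>] by auto
    \<comment> \<open>Relative to the centre, antipodal values are opposite, so the \<open>b\<close>
      components are too. By \<open>N\<close> the same holds for the \<open>a\<close> components,
      whose sum is twice the derivative of the centre.\<close>
    have ab: "F.a \<theta> 0 + F.a \<theta> pi = 0 \<and> H.a \<theta> 0 + H.a \<theta> pi = 0" if t: "\<theta> \<in> {0<..<pi}" for \<theta>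
    proof -
      have "sin \<theta> * (F.b \<theta> 0 + F.b \<theta> pi) = 0" "sin \<theta> * (H.b \<theta> 0 + H.b \<theta> pi) = 0"
        using circle[OF t, of 0] circle[OF t, of pi] by (auto simp: distrib_left c_def d_def)
      then have "F.b \<theta> pi = - F.b \<theta> 0" "H.b \<theta> pi = - H.b \<theta> 0"
        using s[OF t] by (auto simp: eq_neg_iff_add_eq_0 add.commute)
      then show ?thesis using N[of \<theta> 0] N[of \<theta> pi] t by auto
    qed
    have "(c has_real_derivative 0) (at \<theta>)" "(d has_real_derivative 0) (at \<theta>)" if "\<theta> \<in> {0<..<pi}" for \<theta>
      using ab[OF that] unfolding c_def[abs_def] d_def[abs_def]
      by (auto intro!: derivative_eq_intros F.du_\<theta> H.du_\<theta>)
    then show "c \<theta> = c (pi / 2)" "d \<theta> = d (pi / 2)"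
      using t by (auto intro: DERIV_isconst3[of 0 pi \<theta> "pi / 2" c] DERIV_isconst3[of 0 pi \<theta> "pi / 2" d])
  qed
  let ?c = "c (pi / 2)" and ?d = "d (pi / 2)"
  define A where "A = F.u (pi / 2) 0 - ?c"
  define B where "B = - (H.u (pi / 2) 0 - ?d)"
  have inner: "F.u \<theta> \<psi> = sin \<theta> * (A * cos \<psi> + B * sin \<psi>) + ?c \<and> H.u \<theta> \<psi> = sin \<theta> * (A * sin \<psi> - B * cos \<psi>) + ?d"
    if t: "\<theta> \<in> {0<..<pi}" and p: "\<psi> \<in> {0..2 * pi}" for \<theta> \<psi>
  proof -
    have "F.u \<theta> \<psi> - ?c = sin \<theta> * (F.u (pi / 2) \<psi> - ?c)"
    proof (rule DERIV_ratio_sin[where D = "\<lambda>\<theta>. F.u \<theta> \<psi> - ?c" and D' = "\<lambda>\<theta>. F.a \<theta> \<psi>"])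
      fix s assume s: "s \<in> {0<..<pi}"
      then show "sin s * F.a s \<psi> = cos s * (F.u s \<psi> - ?c)"
        using N[of s \<psi>] circle[OF s p] dc[OF s] p by (auto simp: mult.left_commute)
    qed (use t in \<open>auto intro!: derivative_eq_intros F.du_\<theta>\<close>)
    moreover have "H.u \<theta> \<psi> - ?d = sin \<theta> * (H.u (pi / 2) \<psi> - ?d)"
    proof (rule DERIV_ratio_sin[where D = "\<lambda>\<theta>. H.u \<theta> \<psi> - ?d" and D' = "\<lambda>\<theta>. H.a \<theta> \<psi>"])
      fix s assume s: "s \<in> {0<..<pi}"
      have "sin s * H.a s \<psi> = cos s * - (sin s * F.b s \<psi>)"
        using N[of s \<psi>] s p by auto
      then show "sin s * H.a s \<psi> = cos s * (H.u s \<psi> - ?d)"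
        using circle[OF s p] dd[OF s] by simp
    qed (use t in \<open>auto intro!: derivative_eq_intros H.du_\<theta>\<close>)
    moreover have "F.u (pi / 2) \<psi> - ?c = A * cos \<psi> + B * sin \<psi>" "H.u (pi / 2) \<psi> - ?d = A * sin \<psi> - B * cos \<psi>"
      using circle[of "pi / 2" \<psi>] p by (simp_all add: A_def B_def del: minus_diff_eq)
    ultimately have "F.u \<theta> \<psi> - ?c = sin \<theta> * (A * cos \<psi> + B * sin \<psi>)"
      "H.u \<theta> \<psi> - ?d = sin \<theta> * (A * sin \<psi> - B * cos \<psi>)" by simp_all
    then show ?thesis by linarith
  qed
  \<comment> \<open>The circle equations were derived away from the poles; continuity in \<theta>
    extends their solution.\<close>
  have closed: "F.u \<theta> \<psi> = sin \<theta> * (A * cos \<psi> + B * sin \<psi>) + ?c \<and> H.u \<theta> \<psi> = sin \<theta> * (A * sin \<psi> - B * cos \<psi>) + ?d"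
    if t: "\<theta> \<in> {0..pi}" and p: "\<psi> \<in> {0..2 * pi}" for \<theta> \<psi>
  proof -
    have "F.u \<theta> \<psi> - (sin \<theta> * (A * cos \<psi> + B * sin \<psi>) + ?c) = 0"
      by (rule continuous_zero_closed_interval[of 0 pi "\<lambda>\<theta>. F.u \<theta> \<psi> - (sin \<theta> * (A * cos \<psi> + B * sin \<psi>) + ?c)"])
         (use inner t p in \<open>auto intro!: continuous_intros conts2\<close>)
    moreover have "H.u \<theta> \<psi> - (sin \<theta> * (A * sin \<psi> - B * cos \<psi>) + ?d) = 0"
      by (rule continuous_zero_closed_interval[of 0 pi "\<lambda>\<theta>. H.u \<theta> \<psi> - (sin \<theta> * (A * sin \<psi> - B * cos \<psi>) + ?d)"])
         (use inner t p in \<open>auto intro!: continuous_intros conts2\<close>)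
    ultimately show ?thesis by simp
  qed
  have "f x = A * x $ 1 + B * x $ 2 + ?c \<and> h x = - B * x $ 1 + A * x $ 2 + ?d" if x: "x \<in> S2" for x
  proof -
    obtain \<theta> \<psi> where x: "\<theta> \<in> {0..pi}" "0 \<le> \<psi>" "\<psi> < 2 * pi" "x = spherical \<theta> \<psi>"
      using \<open>x \<in> S2\<close> by (metis S2_eq_spherical)
    then show ?thesis using closed[of \<theta> \<psi>] by (simp add: F.u_def H.u_def algebra_simps)
  qed
  then show ?thesis unfolding linear_pair_def by blast
qed

lemma energy_eq_0_if_linear_pair:
  assumes linear_pair
  shows "energy = 0"
proof -
  obtain A B c d where fh: "\<And>x. x \<in> S2 \<Longrightarrow> f x = A * x $ 1 + B * x $ 2 + c"
    "\<And>x. x \<in> S2 \<Longrightarrow> h x = - B * x $ 1 + A * x $ 2 + d"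
    using assms unfolding linear_pair_def by blast
  have u: "F.u = (\<lambda>\<theta> \<psi>. sin \<theta> * (A * cos \<psi> + B * sin \<psi>) + c)"
    and w: "H.u = (\<lambda>\<theta> \<psi>. sin \<theta> * (A * sin \<psi> - B * cos \<psi>) + d)"
    by (simp_all add: fun_eq_iff F.u_def H.u_def fh algebra_simps)
  have a: "F.a \<theta> \<psi> = cos \<theta> * (A * cos \<psi> + B * sin \<psi>)" for \<theta> \<psi>
    by (rule DERIV_unique[OF F.du_\<theta>]) (auto simp: u intro!: derivative_eq_intros)
  have a': "H.a \<theta> \<psi> = cos \<theta> * (A * sin \<psi> - B * cos \<psi>)" for \<theta> \<psi>
    by (rule DERIV_unique[OF H.du_\<theta>]) (auto simp: w intro!: derivative_eq_intros)
  have b: "sin \<theta> * F.b \<theta> \<psi> = - (H.u \<theta> \<psi> - d)" for \<theta> \<psi>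
    by (rule DERIV_unique[OF F.du_\<psi>]) (auto simp: u w algebra_simps intro!: derivative_eq_intros)
  have b': "sin \<theta> * H.b \<theta> \<psi> = F.u \<theta> \<psi> - c" for \<theta> \<psi>
    by (rule DERIV_unique[OF H.du_\<psi>]) (auto simp: u w algebra_simps intro!: derivative_eq_intros)
  \<comment> \<open>The components \<open>b\<close> are known only through their products with sin
    \<theta>; the weighted \<open>N\<close> is all that enters \<open>energy_eq\<close>.\<close>
  have sN: "sin \<theta> * N \<theta> \<psi> = 0" for \<theta> \<psi>
  proof (cases "sin \<theta> = 0")
    case False
    then have *: "F.b \<theta> \<psi> = - (A * sin \<psi> - B * cos \<psi>)" "H.b \<theta> \<psi> = A * cos \<psi> + B * sin \<psi>"
      using b[of \<theta> \<psi>] b'[of \<theta> \<psi>] unfolding u w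
      by (metis add_diff_cancel_right' mult_left_cancel mult_minus_right)+
    show ?thesis unfolding N_def a a' * by (simp del: minus_diff_eq)
  qed simp
  have "W \<theta> = 0" for \<theta>
  proof -
    let ?p = "\<lambda>\<psi>. F.u \<theta> \<psi> - c" and ?q = "\<lambda>\<psi>. H.u \<theta> \<psi> - d"
    have dp: "(?p has_real_derivative - ?q \<psi>) (at \<psi> within T)" for \<psi> T
      using F.du_\<psi>[of \<theta> \<psi>, THEN DERIV_subset] b by (auto intro!: derivative_eq_intros)
    have dq: "(?q has_real_derivative ?p \<psi>) (at \<psi> within T)" for \<psi> T
      using H.du_\<psi>[of \<theta> \<psi>, THEN DERIV_subset] b' by (auto intro!: derivative_eq_intros)
    \<comment> \<open>With p' = -q and q' = p the integrand is q^2 - p^2 - 2cp, the derivative of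
      the periodic function -qp - 2cq.\<close>
    have "((\<lambda>\<psi>. (sin \<theta> * F.b \<theta> \<psi>)\<^sup>2 + (sin \<theta> * H.b \<theta> \<psi>)\<^sup>2 - 2 * (F.u \<theta> \<psi> * (sin \<theta> * H.b \<theta> \<psi>))) has_integral
      ((- (?q (2 * pi) * ?p (2 * pi)) - 2 * c * ?q (2 * pi)) - (- (?q 0 * ?p 0) - 2 * c * ?q 0))) {0..2 * pi}"
    proof (rule fundamental_theorem_of_calculus)
      fix \<psi>
      have "((\<lambda>\<psi>. - (?q \<psi> * ?p \<psi>) - 2 * c * ?q \<psi>) has_real_derivative
          - (?p \<psi> * ?p \<psi> + - ?q \<psi> * ?q \<psi>) - 2 * c * ?p \<psi>) (at \<psi> within {0..2 * pi})"
        by (intro DERIV_diff DERIV_minus DERIV_mult dp dq DERIV_cmult)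
      moreover have "- (?p \<psi> * ?p \<psi> + - ?q \<psi> * ?q \<psi>) - 2 * c * ?p \<psi>
         = (sin \<theta> * F.b \<theta> \<psi>)\<^sup>2 + (sin \<theta> * H.b \<theta> \<psi>)\<^sup>2 - 2 * (F.u \<theta> \<psi> * (sin \<theta> * H.b \<theta> \<psi>))"
        unfolding b b' by (simp add: power2_eq_square algebra_simps)
      ultimately show "((\<lambda>\<psi>. - (?q \<psi> * ?p \<psi>) - 2 * c * ?q \<psi>) has_vector_derivative
          (sin \<theta> * F.b \<theta> \<psi>)\<^sup>2 + (sin \<theta> * H.b \<theta> \<psi>)\<^sup>2 - 2 * (F.u \<theta> \<psi> * (sin \<theta> * H.b \<theta> \<psi>))) (at \<psi> within {0..2 * pi})"
        by (simp only: has_real_derivative_iff_has_vector_derivative)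
    qed simp
    then show ?thesis
      unfolding W_def using F.u_periodic[of \<theta> 0] H.u_periodic[of \<theta> 0] by (simp add: integral_unique)
  qed
  then show ?thesis unfolding energy_eq by (simp add: sN chart_integral_def)
qed

end

section \<open>The sharp inequality\<close>

text \<open>The gradients are arguments so that the statement can be carried along
  \<open>cyc\<close>. The indices \<open>i + 1\<close> and \<open>i + 2\<close>, taken modulo three,
  encode the even permutation.\<close>

definition sharp_ineq :: "3 \<Rightarrow> (real^3 \<Rightarrow> real) \<Rightarrow> (real^3 \<Rightarrow> real^3) \<Rightarrow> (real^3 \<Rightarrow> real) \<Rightarrow> (real^3 \<Rightarrow> real^3) \<Rightarrow> bool" where
  "sharp_ineq i f Gf h Gh \<longleftrightarrow>
     2 * (\<integral>x. x $ i * (J_S2 x (Gf x) \<bullet> Gh x) \<partial>area_S2)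
       \<le> sqrt (\<integral>x. (norm (Gf x))\<^sup>2 \<partial>area_S2) * sqrt (\<integral>x. (norm (Gh x))\<^sup>2 \<partial>area_S2) \<and>
     (2 * (\<integral>x. x $ i * (J_S2 x (Gf x) \<bullet> Gh x) \<partial>area_S2)
       = sqrt (\<integral>x. (norm (Gf x))\<^sup>2 \<partial>area_S2) * sqrt (\<integral>x. (norm (Gh x))\<^sup>2 \<partial>area_S2)
     \<longleftrightarrow> f constant_on S2 \<or> h constant_on S2 \<or>
        (\<exists>a A B c c'. a > 0 \<and> (\<forall>x\<in>S2. f x = A * x $ (i + 1) + B * x $ (i + 2) + c) \<and>
           (\<forall>x\<in>S2. h x = a * (- B * x $ (i + 1) + A * x $ (i + 2)) + c')))"

lemma space_area_S2 [simp]: "space area_S2 = S2"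
  by (simp add: area_S2_def space_restrict_space)

context C1_S2_pair
begin

definition I :: real where "I = (\<integral>x. x $ 3 * (J_S2 x (Gf x) \<bullet> Gh x) \<partial>area_S2)"

lemma scaled_pair: "C1_S2_pair (\<lambda>x. s * f x) (\<lambda>x. s *\<^sub>R Gf x) (\<lambda>x. r * h x) (\<lambda>x. r *\<^sub>R Gh x)"
  unfolding C1_S2_pair_def using F.scale H.scale by blast

lemma energy_scaled:
  "C1_S2_pair.energy (\<lambda>x. s *\<^sub>R Gf x) (\<lambda>x. r *\<^sub>R Gh x) =
     s\<^sup>2 * (\<integral>x. (norm (Gf x))\<^sup>2 \<partial>area_S2) + r\<^sup>2 * (\<integral>x. (norm (Gh x))\<^sup>2 \<partial>area_S2) - 4 * (s * r) * I"
proof -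
  have "(\<integral>x. x $ 3 * (J_S2 x (s *\<^sub>R Gf x) \<bullet> (r *\<^sub>R Gh x)) \<partial>area_S2)
      = (\<integral>x. (s * r) * (x $ 3 * (J_S2 x (Gf x) \<bullet> Gh x)) \<partial>area_S2)"
    by (rule Bochner_Integration.integral_cong) (simp_all add: J_S2_def cross_mult_right)
  then have "(\<integral>x. x $ 3 * (J_S2 x (s *\<^sub>R Gf x) \<bullet> (r *\<^sub>R Gh x)) \<partial>area_S2) = s * r * I"
    by (simp add: I_def)
  then show ?thesis
    unfolding C1_S2_pair.energy_def[OF scaled_pair] by (simp add: power_mult_distrib)
qed

lemma sharp_ineq_nonconstant:
  assumes F0: "(\<integral>x. (norm (Gf x))\<^sup>2 \<partial>area_S2) > 0" and H0: "(\<integral>x. (norm (Gh x))\<^sup>2 \<partial>area_S2) > 0"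
  shows "2 * I \<le> sqrt (\<integral>x. (norm (Gf x))\<^sup>2 \<partial>area_S2) * sqrt (\<integral>x. (norm (Gh x))\<^sup>2 \<partial>area_S2)"
    and "2 * I = sqrt (\<integral>x. (norm (Gf x))\<^sup>2 \<partial>area_S2) * sqrt (\<integral>x. (norm (Gh x))\<^sup>2 \<partial>area_S2) \<longleftrightarrow>
       (\<exists>a A B c c'. a > 0 \<and> (\<forall>x\<in>S2. f x = A * x $ 1 + B * x $ 2 + c) \<and>
           (\<forall>x\<in>S2. h x = a * (- B * x $ 1 + A * x $ 2) + c'))"
proof -
  define p where "p = sqrt (\<integral>x. (norm (Gf x))\<^sup>2 \<partial>area_S2)"
  define q where "q = sqrt (\<integral>x. (norm (Gh x))\<^sup>2 \<partial>area_S2)"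
  have pq: "p > 0" "q > 0" using F0 H0 by (simp_all add: p_def q_def)
  have p2: "(\<integral>x. (norm (Gf x))\<^sup>2 \<partial>area_S2) = p\<^sup>2" and q2: "(\<integral>x. (norm (Gh x))\<^sup>2 \<partial>area_S2) = q\<^sup>2"
    using F0 H0 by (simp_all add: p_def q_def)
  \<comment> \<open>Balances the two Dirichlet integrals: both become \<open>p * q\<close>, so their
    sum is twice the product of the original norms.\<close>
  define s where "s = sqrt (q / p)"
  have s: "s > 0" "s\<^sup>2 = q / p" using pq by (simp_all add: s_def)
  have es: "C1_S2_pair.energy (\<lambda>x. s *\<^sub>R Gf x) (\<lambda>x. (1 / s) *\<^sub>R Gh x) = 2 * (p * q) - 4 * I"
    unfolding energy_scaled p2 q2 using s pq
    by (simp add: power_divide) (simp add: power2_eq_square)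
  have le: "2 * I \<le> p * q"
    using C1_S2_pair.energy_nonneg[OF scaled_pair, of s "1 / s"] unfolding es by linarith
  then show "2 * I \<le> sqrt (\<integral>x. (norm (Gf x))\<^sup>2 \<partial>area_S2) * sqrt (\<integral>x. (norm (Gh x))\<^sup>2 \<partial>area_S2)"
    by (simp only: p_def q_def)
  have "2 * I = p * q \<longleftrightarrow> (\<exists>a A B c c'. a > 0 \<and> (\<forall>x\<in>S2. f x = A * x $ 1 + B * x $ 2 + c) \<and>
           (\<forall>x\<in>S2. h x = a * (- B * x $ 1 + A * x $ 2) + c'))" (is "_ \<longleftrightarrow> ?form")
  proof
    assume "2 * I = p * q"
    then have "C1_S2_pair.energy (\<lambda>x. s *\<^sub>R Gf x) (\<lambda>x. (1 / s) *\<^sub>R Gh x) = 0" unfolding es by linarith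
    from C1_S2_pair.linear_pair_if_energy_eq_0[OF scaled_pair this]
    obtain A B c c' where "\<forall>x\<in>S2. s * f x = A * x $ 1 + B * x $ 2 + c \<and> 1 / s * h x = - B * x $ 1 + A * x $ 2 + c'"
      unfolding C1_S2_pair.linear_pair_def[OF scaled_pair] by blast
    then have fh: "s * f x = A * x $ 1 + B * x $ 2 + c" "1 / s * h x = - B * x $ 1 + A * x $ 2 + c'" if "x \<in> S2" for x
      using that by blast+
    have "f x = A / s * x $ 1 + B / s * x $ 2 + c / s" if "x \<in> S2" for x
      using fh(1)[OF that] s by (simp add: field_simps)
    \<comment> \<open>Undoing the scaling divides the coefficients of \<open>f\<close> by
      \<open>s\<close> and multiplies those of \<open>h\<close> by \<open>s\<close>; the ratio
      \<open>s\<^sup>2\<close> is the factor \<open>a\<close>.\<close>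
    moreover have "h x = s\<^sup>2 * (- (B / s) * x $ 1 + A / s * x $ 2) + s * c'" if "x \<in> S2" for x
    proof -
      have "h x = s * (1 / s * h x)" using s(1) by simp
      also have "\<dots> = s\<^sup>2 * (- (B / s) * x $ 1 + A / s * x $ 2) + s * c'"
        unfolding fh(2)[OF that] using s(1) by (simp add: field_simps power2_eq_square)
      finally show ?thesis .
    qed
    moreover have "s\<^sup>2 > 0" using s(1) by simp
    ultimately show ?form by blast
  next
    assume ?form
    then obtain a A B c c' where a: "a > 0" and fh: "\<And>x. x \<in> S2 \<Longrightarrow> f x = A * x $ 1 + B * x $ 2 + c"
      "\<And>x. x \<in> S2 \<Longrightarrow> h x = a * (- B * x $ 1 + A * x $ 2) + c'" by blast
    \<comment> \<open>Scaling by \<open>t\<close> and \<open>1 / t\<close> shares the factor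
      \<open>a\<close> evenly and produces a linear pair. Its zero energy and the inequality of the
      means then give \<open>p * q \<le> 2 * I\<close>.\<close>
    define t where "t = sqrt a"
    have t: "t > 0" "a = t * t" using a by (simp_all add: t_def)
    have "t * f x = (t * A) * x $ 1 + (t * B) * x $ 2 + t * c \<and> 1 / t * h x = - (t * B) * x $ 1 + (t * A) * x $ 2 + c' / t"
      if "x \<in> S2" for x
      using t(1) unfolding fh[OF that] t(2) by (simp add: field_simps)
    then have "C1_S2_pair.linear_pair (\<lambda>x. t * f x) (\<lambda>x. 1 / t * h x)"
      unfolding C1_S2_pair.linear_pair_def[OF scaled_pair] by blast
    from C1_S2_pair.energy_eq_0_if_linear_pair[OF scaled_pair this]
    have "4 * I = (t * p)\<^sup>2 + (q / t)\<^sup>2"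
      unfolding energy_scaled p2 q2 using t(1) by (simp add: power_mult_distrib power_divide)
    moreover have "2 * (t * p) * (q / t) \<le> (t * p)\<^sup>2 + (q / t)\<^sup>2"
      by (rule sum_squares_bound)
    ultimately have "p * q \<le> 2 * I" using t(1) by simp
    with le show "2 * I = p * q" by linarith
  qed
  then show "2 * I = sqrt (\<integral>x. (norm (Gf x))\<^sup>2 \<partial>area_S2) * sqrt (\<integral>x. (norm (Gh x))\<^sup>2 \<partial>area_S2) \<longleftrightarrow>
       (\<exists>a A B c c'. a > 0 \<and> (\<forall>x\<in>S2. f x = A * x $ 1 + B * x $ 2 + c) \<and>
           (\<forall>x\<in>S2. h x = a * (- B * x $ 1 + A * x $ 2) + c'))"
    by (simp only: p_def q_def)
qed

text \<open>If one function is constant, both sides are zero; otherwise both Dirichlet integrals are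
  positive and the balancing factor exists.\<close>

lemma sharp_ineq_3: "sharp_ineq 3 f Gf h Gh"
proof (cases "f constant_on S2 \<or> h constant_on S2")
  case True
  then have "(\<forall>x\<in>S2. Gf x = 0) \<or> (\<forall>x\<in>S2. Gh x = 0)"
    using F.grad_eq_0_iff_constant H.grad_eq_0_iff_constant by blast
  then have "(\<integral>x. x $ 3 * (J_S2 x (Gf x) \<bullet> Gh x) \<partial>area_S2) = (\<integral>x. 0 \<partial>area_S2)"
    by (intro Bochner_Integration.integral_cong) (auto simp: J_S2_def)
  moreover have "(\<integral>x. (norm (Gf x))\<^sup>2 \<partial>area_S2) = 0 \<or> (\<integral>x. (norm (Gh x))\<^sup>2 \<partial>area_S2) = 0"
    using True F.dirichlet_eq_0_iff H.dirichlet_eq_0_iff by blast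
  ultimately show ?thesis using True unfolding sharp_ineq_def by auto
next
  case False
  have "(\<integral>x. (norm (Gf x))\<^sup>2 \<partial>area_S2) > 0" "(\<integral>x. (norm (Gh x))\<^sup>2 \<partial>area_S2) > 0"
    using False F.dirichlet_eq_0_iff H.dirichlet_eq_0_iff F.dirichlet_nonneg H.dirichlet_nonneg
    by (metis order_less_le)+
  note * = sharp_ineq_nonconstant[OF this, unfolded I_def]
  have "(3 :: 3) + 1 = 1" "(3 :: 3) + 2 = 2" by simp_all
  then show ?thesis using * False unfolding sharp_ineq_def by (simp only:) blast
qed

end

section \<open>The other coordinates and the even permutations\<close>

text \<open>The gradient is pulled back by the transpose of \<open>cyc\<close>, which is its inverse
  \<open>cyc \<circ> cyc\<close>.\<close>

lemma C1_S2_cyc: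
  assumes "C1_S2 f G"
  shows "C1_S2 (\<lambda>y. f (cyc y)) (\<lambda>y. cyc (cyc (G (cyc y))))"
proof -
  interpret C1_S2 f G by fact
  have S: "cyc y \<in> S2" if "y \<in> S2" for y using that by simp
  have adj: "cyc (cyc v) \<bullet> w = v \<bullet> cyc w" for v w
    by (metis cyc_cyc_cyc inner_cyc)
  show ?thesis
  proof
    show "continuous_on S2 (\<lambda>y. cyc (cyc (G (cyc y))))"
      by (intro continuous_intros continuous_on_compose2[OF cont_grad]) (auto simp: S)
    fix x assume x: "x \<in> S2"
    show "x \<bullet> cyc (cyc (G (cyc x))) = 0"
      using tangent[OF S[OF x]] adj[of "G (cyc x)" x] by (simp add: inner_commute)
    have "(cyc has_derivative cyc) (at x within S2)"
      using linear_cyc by (simp add: linear_imp_has_derivative)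
    then have "((\<lambda>y. f (cyc y)) has_derivative (\<lambda>w. G (cyc x) \<bullet> cyc w)) (at x within S2)"
      by (rule has_derivative_in_compose) (rule has_derivative_subset[OF deriv[OF S[OF x]]], auto)
    then show "((\<lambda>y. f (cyc y)) has_derivative (\<bullet>) (cyc (cyc (G (cyc x))))) (at x within S2)"
      unfolding adj[symmetric] .
  qed
qed

lemma ball_S2_cyc: "(\<forall>y\<in>S2. P (cyc y)) \<longleftrightarrow> (\<forall>x\<in>S2. P x)"
proof
  assume P: "\<forall>y\<in>S2. P (cyc y)"
  show "\<forall>x\<in>S2. P x"
  proof
    fix x :: "real^3" assume "x \<in> S2"
    then have "cyc (cyc x) \<in> S2" by simp
    with P have "P (cyc (cyc (cyc x)))" by blast
    then show "P x" by simp
  qed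
qed simp

text \<open>As a rotation, \<open>cyc\<close> preserves the area and commutes with the cross
  product, hence with \<open>J_S2\<close>. Coordinate \<open>i\<close> of a point is coordinate
  \<open>i + 1\<close> of its image, which shifts the index.\<close>

lemma sharp_ineq_cyc:
  assumes "C1_S2 f Gf" "C1_S2 h Gh"
    and sharp: "sharp_ineq i (\<lambda>y. f (cyc y)) (\<lambda>y. cyc (cyc (Gf (cyc y)))) (\<lambda>y. h (cyc y)) (\<lambda>y. cyc (cyc (Gh (cyc y))))"
  shows "sharp_ineq (i + 1) f Gf h Gh"
proof -
  interpret C1_S2_pair f Gf h Gh using assms by (simp add: C1_S2_pair_def)
  have nth: "y $ j = cyc y $ (j + 1)" for y j by (simp add: cyc_def)
  have i: "i + 1 + 2 = i + 2 + 1" by simp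
  have nth': "y $ (i + 1) = cyc y $ (i + 1 + 1)" "y $ (i + 2) = cyc y $ (i + 1 + 2)" for y
    unfolding i by (rule nth)+
  have J: "y $ i * (J_S2 y (cyc (cyc v)) \<bullet> cyc (cyc w)) = cyc y $ (i + 1) * (J_S2 (cyc y) v \<bullet> w)" for y v w
  proof -
    have "J_S2 y (cyc (cyc v)) = cyc (cyc (J_S2 (cyc y) v))"
      unfolding J_S2_def by (metis cross3_cyc cyc_cyc_cyc)
    then show ?thesis using nth[of y i] by simp
  qed
  have "(\<integral>y. y $ i * (J_S2 y (cyc (cyc (Gf (cyc y)))) \<bullet> cyc (cyc (Gh (cyc y)))) \<partial>area_S2)
      = (\<integral>x. x $ (i + 1) * (J_S2 x (Gf x) \<bullet> Gh x) \<partial>area_S2)"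
    unfolding J
    by (rule integral_area_S2_cyc)
       (unfold J_S2_def, intro continuous_intros continuous_on_cross F.cont_grad H.cont_grad)
  moreover have "(\<integral>y. (norm (Gf (cyc y)))\<^sup>2 \<partial>area_S2) = (\<integral>x. (norm (Gf x))\<^sup>2 \<partial>area_S2)"
    "(\<integral>y. (norm (Gh (cyc y)))\<^sup>2 \<partial>area_S2) = (\<integral>x. (norm (Gh x))\<^sup>2 \<partial>area_S2)"
    by (intro integral_area_S2_cyc continuous_intros F.cont_grad H.cont_grad)+
  moreover have "(\<lambda>y. f (cyc y)) constant_on S2 \<longleftrightarrow> f constant_on S2" "(\<lambda>y. h (cyc y)) constant_on S2 \<longleftrightarrow> h constant_on S2"
    by (simp_all only: constant_on_def ball_S2_cyc[where P = "\<lambda>x. f x = c" for c] ball_S2_cyc[where P = "\<lambda>x. h x = c" for c])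
  moreover have "(\<forall>y\<in>S2. f (cyc y) = A * y $ (i + 1) + B * y $ (i + 2) + c)
      \<longleftrightarrow> (\<forall>x\<in>S2. f x = A * x $ (i + 1 + 1) + B * x $ (i + 1 + 2) + c)" for A B c
    unfolding nth' by (rule ball_S2_cyc[of "\<lambda>x. f x = A * x $ (i + 1 + 1) + B * x $ (i + 1 + 2) + c"])
  moreover have "(\<forall>y\<in>S2. h (cyc y) = a * (- B * y $ (i + 1) + A * y $ (i + 2)) + c)
      \<longleftrightarrow> (\<forall>x\<in>S2. h x = a * (- B * x $ (i + 1 + 1) + A * x $ (i + 1 + 2)) + c)" for a A B c
    unfolding nth' by (rule ball_S2_cyc[of "\<lambda>x. h x = a * (- B * x $ (i + 1 + 1) + A * x $ (i + 1 + 2)) + c"])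
  ultimately show ?thesis
    using sharp unfolding sharp_ineq_def by (simp only: norm_cyc)
qed

text \<open>The index runs through 3, 1, 2, starting at the axis of the chart.\<close>

lemma sharp_ineq_all:
  assumes "C1_S2 f Gf" "C1_S2 h Gh"
  shows "sharp_ineq i f Gf h Gh"
proof -
  have 3: "sharp_ineq 3 f Gf h Gh" if "C1_S2 f Gf" "C1_S2 h Gh" for f Gf h Gh
    by (rule C1_S2_pair.sharp_ineq_3) (simp add: C1_S2_pair_def that)
  have "(3 :: 3) + 1 = 1" by simp
  then have 1: "sharp_ineq 1 f Gf h Gh" if "C1_S2 f Gf" "C1_S2 h Gh" for f Gf h Gh
    using sharp_ineq_cyc[OF that 3[OF that[THEN C1_S2_cyc]]] by (simp only:)
  have 2: "sharp_ineq 2 f Gf h Gh" if "C1_S2 f Gf" "C1_S2 h Gh" for f Gf h Gh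
    using sharp_ineq_cyc[OF that 1[OF that[THEN C1_S2_cyc]]] by simp
  show ?thesis using exhaust_3[of i] 1 2 3 assms by metis
qed

lemma even_triple_iff: "even_triple i j k \<longleftrightarrow> j = i + 1 \<and> k = i + 2"
proof
  assume "even_triple i j k"
  then obtain p where p: "p permutes (UNIV :: 3 set)" "evenperm p" "p 1 = i" "p 2 = j" "p 3 = k"
    unfolding even_triple_def by blast
  have inj: "inj p" using p(1) permutes_inj by blast
  have ne: "i \<noteq> j" "j \<noteq> k" "i \<noteq> k"
    unfolding p(3-5)[symmetric] inj_eq[OF inj] by simp_all
  \<comment> \<open>Of the six triples of distinct indices, the three that are not cyclic belong to
    transpositions, which are odd.\<close>
  have "p \<noteq> Transposition.transpose 2 3" "p \<noteq> Transposition.transpose 1 2" "p \<noteq> Transposition.transpose 1 3"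
    using p(2) by (auto simp: evenperm_swap)
  then have "\<not> (i = 1 \<and> j = 3 \<and> k = 2)" "\<not> (i = 2 \<and> j = 1 \<and> k = 3)" "\<not> (i = 3 \<and> j = 2 \<and> k = 1)"
    using p(3-5) by (auto simp: fun_eq_iff forall_3)
  then show "j = i + 1 \<and> k = i + 2"
    using exhaust_3[of i] exhaust_3[of j] exhaust_3[of k] ne by auto
next
  assume jk: "j = i + 1 \<and> k = i + 2"
  have even: "evenperm (Transposition.transpose a b \<circ> Transposition.transpose c d)" if "a \<noteq> b" "c \<noteq> d" for a b c d :: 3
    using that by (simp add: evenperm_comp evenperm_swap permutation_swap_id)
  show "even_triple i j k"
    using exhaust_3[of i]
  proof (elim disjE)
    assume "i = 1"
    then show ?thesis using jk unfolding even_triple_def by (intro exI[of _ id]) (auto simp: permutes_id)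
  next
    assume "i = 2"
    then show ?thesis using jk even[of 1 2 2 3] unfolding even_triple_def
      by (intro exI[of _ "Transposition.transpose 1 2 \<circ> Transposition.transpose 2 3"]) (auto intro!: permutes_compose permutes_swap_id)
  next
    assume "i = 3"
    then show ?thesis using jk even[of 1 3 2 3] unfolding even_triple_def
      by (intro exI[of _ "Transposition.transpose 1 3 \<circ> Transposition.transpose 2 3"]) (auto intro!: permutes_compose permutes_swap_id)
  qed
qed

text \<open>Both sides are multiplied by \<open>s * r\<close> when \<open>f\<close> and
  \<open>h\<close> are replaced by \<open>s f\<close> and \<open>r h\<close> with positive
  \<open>s\<close> and \<open>r\<close>, so the equality pairs are closed under such scalings. The
  factor \<open>a\<close> accounts for this: \<phi>_j and 2 \<phi>_k, for example, attain
  equality.\<close>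

theorem theorem1p1:
  fixes i :: 3 and f h :: "real^3 \<Rightarrow> real"
  assumes "smooth_on_S2 f" and "smooth_on_S2 h"
  shows "2 * (\<integral>x. x $ i * (J_S2 x (grad_S2 f x) \<bullet> grad_S2 h x) \<partial>area_S2)
           \<le> sqrt (\<integral>x. (norm (grad_S2 f x))\<^sup>2 \<partial>area_S2) * sqrt (\<integral>x. (norm (grad_S2 h x))\<^sup>2 \<partial>area_S2)
       \<and> (2 * (\<integral>x. x $ i * (J_S2 x (grad_S2 f x) \<bullet> grad_S2 h x) \<partial>area_S2)
           = sqrt (\<integral>x. (norm (grad_S2 f x))\<^sup>2 \<partial>area_S2) * sqrt (\<integral>x. (norm (grad_S2 h x))\<^sup>2 \<partial>area_S2)
         \<longleftrightarrow> f constant_on S2 \<or> h constant_on S2 \<or>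
             (\<exists>j k a c\<^sub>j c\<^sub>k c c'. even_triple i j k \<and> a > 0 \<and>
                (\<forall>x\<in>S2. f x = c\<^sub>j * x $ j + c\<^sub>k * x $ k + c) \<and>
                (\<forall>x\<in>S2. h x = a * (- c\<^sub>k * x $ j + c\<^sub>j * x $ k) + c')))"
proof -
  have "sharp_ineq i f (grad_S2 f) h (grad_S2 h)"
    using assms by (intro sharp_ineq_all smooth_on_S2_imp_C1)
  moreover have "(\<exists>j k a c\<^sub>j c\<^sub>k c c'. even_triple i j k \<and> a > 0 \<and>
        (\<forall>x\<in>S2. f x = c\<^sub>j * x $ j + c\<^sub>k * x $ k + c) \<and>
        (\<forall>x\<in>S2. h x = a * (- c\<^sub>k * x $ j + c\<^sub>j * x $ k) + c'))
    \<longleftrightarrow> (\<exists>a A B c c'. a > 0 \<and> (\<forall>x\<in>S2. f x = A * x $ (i + 1) + B * x $ (i + 2) + c) \<and>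
        (\<forall>x\<in>S2. h x = a * (- B * x $ (i + 1) + A * x $ (i + 2)) + c'))"
    unfolding even_triple_iff by (simp only: ex_simps conj_assoc simp_thms)
  ultimately show ?thesis unfolding sharp_ineq_def by (simp only:)
qed

end
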